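(* Assume that (i) the set $A(x)$ is compact for every $x\in X$; (ii) the cost-per-stage function $c:\mathbb K\to\mathbb R$ is lower semicontinuous, nonnegative and inf-compact on $\mathbb K$; and (iii) the transition kernel $Q$ is strongly Feller. Then: (i) The $\alpha$-discount value function $V^\star$ is the minimal nonnegative measurable solution of the $\alpha$-discounted cost optimality equation $$\xi(x)=\min_{a\in A(x)}\left[c(x,a)+\alpha\int_{X\setminus K}Q(\mathrm dy\mid x,a)\,\xi(y)\right]\qquad\text{for all }x\in X\setminus K,$$ i.e. $V^\star$ is a nonnegative (extended real-valued) measurable function on $X\setminus K$ that solves this equation, and every nonnegative (extended real-valued) measurable solution $\xi$ satisfies $\xi\ge V^\star$ on $X\setminus K$. (ii) There exists a selector $f_\star\in\mathbb F$ such that $f_\star(x)\in A(x)$ attains, for every $x\in X\setminus K$, the minimum $\min_{a\in A(x)}\left[c(x,a)+\alpha\int_{X\setminus K}Q(\mathrm dy\mid x,a)\,V^\star(y)\right]$, i.e. $$V^\star(x)=c(x,f_\star)+\alpha\int_{X\setminus K}Q(\mathrm dy\mid x,f_\star)\,V^\star(y)\qquad\text{for all }x\in X\setminus K,\tag{$*$}$$ and the deterministic stationary policy $f_\star^\infty$ is $\alpha$-discount optimal. Conversely, if a deterministic stationary policy $f_\star^\infty$ is $\alpha$-discount optimal, then it satisfies $( * )$.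
   Context: Control model. $X$ (state space) and $A$ (action set) are nonempty Borel subsets of Polish spaces. For each $x\in X$, $A(x)\subseteq A$ is a nonempty measurable set of feasible actions; the set $\{(x,a): x\in X,\ a\in A(x)\}$ is a measurable subset of $X\times A$ and contains the graph of a measurable function from $X$ to $A$. $Q$ is a stochastic kernel on $X$ given the feasible state-action pairs (the transition law). $K\subseteq X$ is a measurable target set (not assumed absorbing), $\mathbb K:=\{(x,a)\in X\times A: x\in X\setminus K,\ a\in A(x)\}$, and $c:\mathbb K\to\mathbb R$ is a measurable cost-per-stage function. $\alpha\in(0,1)$ is fixed. "Measurable" means Borel-measurable. $\mathbb F$ is the set of selectors, i.e. measurable $f:X\setminus K\to A$ with $f(x)\in A(x)$ for all $x\in X\setminus K$; one writes $c(x,f):=c(x,f(x))$ and $Q(\cdot\mid x,f):=Q(\cdot\mid x,f(x))$. Policies and process. $\tau:=\inf\{i\ge 0: x_i\in K\}$ (with $\inf\emptyset=+\infty$) is the first hitting time of $K$. The process is controlled only up to $\tau$: a policy $\pi=(\varphi_t)_{t\ge0}$ in the class $\Pi$ (randomized Markov policies) is a sequence of stochastic kernels $\varphi_t$ on $A$ with $\varphi_t(A(x)\mid x)=1$ for $x\in X\setminus K$. Under $\mathsf P^\pi_x$ one has $x_0=x$ and, on $\{t<\tau\}$, conditionally on the history up to time $t$, $a_t\sim\varphi_t(\cdot\mid x_t)$ and then $x_{t+1}\sim Q(\cdot\mid x_t,a_t)$. For $f\in\mathbb F$, $f^\infty$ denotes the deterministic stationary policy with $a_t=f(x_t)$ for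 all $t<\tau$. Costs. $V(\pi,x):=\mathsf E^\pi_x\big[\sum_{i=0}^{\tau-1}\alpha^i c(x_i,a_i)\big]$ and $V^\star(x):=\inf_{\pi\in\Pi}V(\pi,x)$, $x\in X\setminus K$ (values in $[0,\infty]$ are allowed). A policy $\pi$ is $\alpha$-discount optimal if $V(\pi,x)=V^\star(x)$ for all $x\in X\setminus K$. Regularity notions. A function $g:\mathbb K\to\mathbb R$ is lower semicontinuous if $\liminf_j g(x_j,a_j)\ge g(x,a)$ whenever $(x_j,a_j)\to(x,a)$ in $\mathbb K$; it is inf-compact on $\mathbb K$ if for every $x\in X\setminus K$ and $r\in\mathbb R$ the set $\{a\in A(x): g(x,a)\le r\}$ is compact. $Q$ is strongly Feller if for every bounded measurable $g:X\to\mathbb R$ the map $(x,a)\mapsto\int_X g(y)\,Q(\mathrm dy\mid x,a)$ is continuous and bounded on $\mathbb K$. *)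

theory Defs
  imports "HOL-Probability.Probability"
begin

text \<open>
  The states and the actions form Borel subsets of types of class \<open>polish_space\<close>. The
  functions \<open>transition\<close> and \<open>cost\<close> are total; only their values at feasible pairs
  (for \<open>cost\<close>: at feasible pairs with a state outside the target) are meaningful.
\<close>

record ('s, 'a) control_data =
  states :: "'s set"
  actions :: "'a set"
  feasible :: "'s \<Rightarrow> 'a set"
  transition :: "'s \<times> 'a \<Rightarrow> 's measure"
  target :: "'s set"
  cost :: "'s \<times> 'a \<Rightarrow> real"
  discount :: real

abbreviation state_algebra :: "('s::polish_space, 'a::polish_space) control_data \<Rightarrow> 's measure" where
  "state_algebra M \<equiv> restrict_space borel (states M)"

abbreviation action_algebra :: "('s::polish_space, 'a::polish_space) control_data \<Rightarrow> 'a measure" where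
  "action_algebra M \<equiv> restrict_space borel (actions M)"

definition nontarget :: "('s, 'a) control_data \<Rightarrow> 's set" where
  "nontarget M = states M - target M"

definition feasible_pairs :: "('s, 'a) control_data \<Rightarrow> ('s \<times> 'a) set" where
  "feasible_pairs M = {(x, a). x \<in> states M \<and> a \<in> feasible M x}"

definition controlled_pairs :: "('s, 'a) control_data \<Rightarrow> ('s \<times> 'a) set" where
  "controlled_pairs M = {(x, a). x \<in> nontarget M \<and> a \<in> feasible M x}"

locale control_model =
  fixes M :: "('s::polish_space, 'a::polish_space) control_data"
  assumes states_borel: "states M \<in> sets borel" and states_nonempty: "states M \<noteq> {}"
    and actions_borel: "actions M \<in> sets borel" and actions_nonempty: "actions M \<noteq> {}"
    and feasible_sub: "\<And>x. x \<in> states M \<Longrightarrow> feasible M x \<subseteq> actions M"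
    and feasible_nonempty: "\<And>x. x \<in> states M \<Longrightarrow> feasible M x \<noteq> {}"
    and feasible_borel: "\<And>x. x \<in> states M \<Longrightarrow> feasible M x \<in> sets borel"
    and feasible_pairs_borel: "feasible_pairs M \<in> sets borel"
    and measurable_graph:
      "\<exists>f \<in> state_algebra M \<rightarrow>\<^sub>M action_algebra M. \<forall>x\<in>states M. f x \<in> feasible M x"
    and transition_kernel:
      "transition M \<in> restrict_space borel (feasible_pairs M) \<rightarrow>\<^sub>M prob_algebra (state_algebra M)"
    and target_sub: "target M \<subseteq> states M" and target_borel: "target M \<in> sets borel"
    and cost_measurable: "cost M \<in> borel_measurable (restrict_space borel (controlled_pairs M))"
    and discount_pos: "0 < discount M" and discount_less_1: "discount M < 1"

definition selectors :: "('s::polish_space, 'a::polish_space) control_data \<Rightarrow> ('s \<Rightarrow> 'a) set" where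
  "selectors M = {f \<in> restrict_space borel (nontarget M) \<rightarrow>\<^sub>M action_algebra M.
     \<forall>x\<in>nontarget M. f x \<in> feasible M x}"

text \<open>
  A randomized Markov policy. As the process is controlled only before the target is hit, the
  kernels are kernels on the actions given a state outside the target.
\<close>

definition policies ::
  "('s::polish_space, 'a::polish_space) control_data \<Rightarrow> (nat \<Rightarrow> 's \<Rightarrow> 'a measure) set" where
  "policies M = {\<pi>. \<forall>t. \<pi> t \<in> restrict_space borel (nontarget M) \<rightarrow>\<^sub>M prob_algebra (action_algebra M) \<and>
     (\<forall>x\<in>nontarget M. emeasure (\<pi> t x) (feasible M x) = 1)}"

definition stationary ::
  "('s::polish_space, 'a::polish_space) control_data \<Rightarrow> ('s \<Rightarrow> 'a) \<Rightarrow> nat \<Rightarrow> 's \<Rightarrow> 'a measure" where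
  "stationary M f = (\<lambda>t x. return (action_algebra M) (f x))"

abbreviation pair_algebra ::
  "('s::polish_space, 'a::polish_space) control_data \<Rightarrow> ('s \<times> 'a) measure" where
  "pair_algebra M \<equiv> state_algebra M \<Otimes>\<^sub>M action_algebra M"

text \<open>
  A trajectory \<open>\<omega>\<close> is a sequence of state-action pairs. The law of the pair at time \<open>t + 1\<close>,
  given the pair \<open>(x, a)\<close> at time \<open>t\<close>: while the target has not been hit, the new state \<open>y\<close> has law
  \<open>transition M (x, a)\<close> and the new action has law \<open>\<pi> (t + 1) y\<close>. There is no action to choose once
  the target is hit; the pair is then completed with the previous action and frozen from there on.
  This filler does not matter, since costs are only summed up to (excluding) the hitting time.
  Pairs with an infeasible action, which have probability zero, are frozen too, so
  that the kernel is measurable on the whole product space.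
\<close>

definition step_kernel ::
  "('s::polish_space, 'a::polish_space) control_data \<Rightarrow> (nat \<Rightarrow> 's \<Rightarrow> 'a measure) \<Rightarrow> nat \<Rightarrow>
    's \<times> 'a \<Rightarrow> ('s \<times> 'a) measure" where
  "step_kernel M \<pi> t z =
     (if z \<in> controlled_pairs M
      then transition M z \<bind> (\<lambda>y.
        if y \<in> target M then return (pair_algebra M) (y, snd z)
        else distr (\<pi> (Suc t) y) (pair_algebra M) (Pair y))
      else return (pair_algebra M) z)"

primrec history_kernel ::
  "('s::polish_space, 'a::polish_space) control_data \<Rightarrow> (nat \<Rightarrow> 's \<Rightarrow> 'a measure) \<Rightarrow> 's \<Rightarrow> nat \<Rightarrow>
    (nat \<Rightarrow> 's \<times> 'a) \<Rightarrow> ('s \<times> 'a) measure" where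
  "history_kernel M \<pi> x 0 = (\<lambda>\<omega>. distr (\<pi> 0 x) (pair_algebra M) (Pair x))"
| "history_kernel M \<pi> x (Suc t) = (\<lambda>\<omega>. step_kernel M \<pi> t (\<omega> t))"

text \<open>
  The law of the trajectory started in \<open>x\<close>, a state outside the target, is the measure given by the
  Ionescu-Tulcea theorem for these kernels.
\<close>

definition trajectory ::
  "('s::polish_space, 'a::polish_space) control_data \<Rightarrow> (nat \<Rightarrow> 's \<Rightarrow> 'a measure) \<Rightarrow> 's \<Rightarrow>
    (nat \<Rightarrow> 's \<times> 'a) measure" where
  "trajectory M \<pi> x =
     projective_family.lim UNIV
       (Ionescu_Tulcea.CI (history_kernel M \<pi> x) (\<lambda>_. pair_algebra M)) (\<lambda>_. pair_algebra M)"

definition hitting_time :: "('s, 'a) control_data \<Rightarrow> (nat \<Rightarrow> 's \<times> 'a) \<Rightarrow> enat" where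
  "hitting_time M \<omega> = Inf {enat i | i. fst (\<omega> i) \<in> target M}"

text \<open>
  Costs are embedded into \<open>[0, \<infinity>]\<close> by \<open>ennreal\<close>, which sends negative numbers to zero: the
  definitions below that involve costs are meaningful for a cost that is nonnegative on the
  controlled pairs.
\<close>

definition policy_value ::
  "('s::polish_space, 'a::polish_space) control_data \<Rightarrow> (nat \<Rightarrow> 's \<Rightarrow> 'a measure) \<Rightarrow> 's \<Rightarrow> ennreal" where
  "policy_value M \<pi> x =
     (\<integral>\<^sup>+\<omega>. (\<Sum>i. if enat i < hitting_time M \<omega> then ennreal (discount M ^ i * cost M (\<omega> i)) else 0)
        \<partial>trajectory M \<pi> x)"

definition opt_value :: "('s::polish_space, 'a::polish_space) control_data \<Rightarrow> 's \<Rightarrow> ennreal" where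
  "opt_value M x = (INF \<pi>\<in>policies M. policy_value M \<pi> x)"

definition discount_optimal ::
  "('s::polish_space, 'a::polish_space) control_data \<Rightarrow> (nat \<Rightarrow> 's \<Rightarrow> 'a measure) \<Rightarrow> bool" where
  "discount_optimal M \<pi> \<longleftrightarrow> \<pi> \<in> policies M \<and> (\<forall>x\<in>nontarget M. policy_value M \<pi> x = opt_value M x)"

definition one_stage ::
  "('s::polish_space, 'a::polish_space) control_data \<Rightarrow> ('s \<Rightarrow> ennreal) \<Rightarrow> 's \<Rightarrow> 'a \<Rightarrow> ennreal" where
  "one_stage M \<xi> x a =
     ennreal (cost M (x, a)) + ennreal (discount M) * (\<integral>\<^sup>+y\<in>nontarget M. \<xi> y \<partial>transition M (x, a))"

text \<open>The minimum in the optimality equation is required to be attained.\<close>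

definition solves_optimality_equation ::
  "('s::polish_space, 'a::polish_space) control_data \<Rightarrow> ('s \<Rightarrow> ennreal) \<Rightarrow> bool" where
  "solves_optimality_equation M \<xi> \<longleftrightarrow>
     (\<forall>x\<in>nontarget M. \<exists>a. is_arg_min (one_stage M \<xi> x) (\<lambda>a. a \<in> feasible M x) a \<and>
        \<xi> x = one_stage M \<xi> x a)"

definition lower_semicontinuous_on ::
  "'z::topological_space set \<Rightarrow> ('z \<Rightarrow> real) \<Rightarrow> bool" where
  "lower_semicontinuous_on S g \<longleftrightarrow>
     (\<forall>u. \<forall>z\<in>S. (\<forall>j. u j \<in> S) \<longrightarrow> u \<longlonglongrightarrow> z \<longrightarrow> ereal (g z) \<le> liminf (\<lambda>j. ereal (g (u j))))"

definition inf_compact ::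
  "('s::polish_space, 'a::polish_space) control_data \<Rightarrow> ('s \<times> 'a \<Rightarrow> real) \<Rightarrow> bool" where
  "inf_compact M g \<longleftrightarrow> (\<forall>x\<in>nontarget M. \<forall>r. compact {a \<in> feasible M x. g (x, a) \<le> r})"

definition strongly_Feller :: "('s::polish_space, 'a::polish_space) control_data \<Rightarrow> bool" where
  "strongly_Feller M \<longleftrightarrow>
     (\<forall>g::'s \<Rightarrow> real. g \<in> borel_measurable (state_algebra M) \<longrightarrow> bounded (g ` states M) \<longrightarrow>
        continuous_on (controlled_pairs M) (\<lambda>z. \<integral>y. g y \<partial>transition M z) \<and>
        bounded ((\<lambda>z. \<integral>y. g y \<partial>transition M z) ` controlled_pairs M))"

context control_model
begin

lemma nontarget_borel: "nontarget M \<in> sets borel"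
  unfolding nontarget_def using states_borel target_borel by (rule sets.Diff)

lemma id_pair_algebra: "(\<lambda>z. z) \<in> pair_algebra M \<rightarrow>\<^sub>M borel"
proof -
  have "(\<lambda>z. (fst z, snd z)) \<in> pair_algebra M \<rightarrow>\<^sub>M borel \<Otimes>\<^sub>M borel"
    by (intro measurable_Pair measurable_compose[OF measurable_fst]
        measurable_compose[OF measurable_snd] measurable_restrict_space1) auto
  then show ?thesis by (simp add: borel_prod)
qed

lemma controlled_pairs_pred: "Measurable.pred (pair_algebra M) (\<lambda>z. z \<in> controlled_pairs M)"
proof -
  have fst_borel: "fst \<in> pair_algebra M \<rightarrow>\<^sub>M borel"
    by (rule measurable_compose[OF measurable_fst measurable_restrict_space1]) simp
  have eq: "z \<in> controlled_pairs M \<longleftrightarrow> z \<in> feasible_pairs M \<and> fst z \<in> nontarget M" for z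
    by (auto simp: controlled_pairs_def feasible_pairs_def nontarget_def)
  have "Measurable.pred (pair_algebra M) (\<lambda>z. z \<in> feasible_pairs M)"
    by (rule measurable_compose[OF id_pair_algebra]) (simp add: feasible_pairs_borel pred_def)
  moreover have "Measurable.pred (pair_algebra M) (\<lambda>z. fst z \<in> nontarget M)"
    by (rule measurable_compose[OF fst_borel]) (simp add: nontarget_borel pred_def)
  ultimately show ?thesis unfolding eq by measurable
qed

lemma policyD:
  assumes "\<pi> \<in> policies M"
  shows "\<pi> t \<in> restrict_space borel (nontarget M) \<rightarrow>\<^sub>M prob_algebra (action_algebra M)"
  using assms by (auto simp: policies_def)

lemma step_kernel_measurable:
  assumes \<pi>: "\<pi> \<in> policies M"
  shows "step_kernel M \<pi> t \<in> pair_algebra M \<rightarrow>\<^sub>M prob_algebra (pair_algebra M)"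
proof -
  let ?S = "pair_algebra M" and ?G = "restrict_space (pair_algebra M) {z. z \<in> controlled_pairs M}"
  have tr: "transition M \<in> ?G \<rightarrow>\<^sub>M prob_algebra (state_algebra M)"
  proof (rule measurable_compose[OF _ transition_kernel])
    show "(\<lambda>z. z) \<in> ?G \<rightarrow>\<^sub>M restrict_space borel (feasible_pairs M)"
      by (intro measurable_restrict_space2 measurable_restrict_space1 id_pair_algebra)
         (auto simp: space_restrict_space controlled_pairs_def feasible_pairs_def nontarget_def)
  qed
  let ?P = "?G \<Otimes>\<^sub>M state_algebra M"
  have snd_borel: "snd \<in> ?P \<rightarrow>\<^sub>M borel"
    by (rule measurable_compose[OF measurable_snd measurable_restrict_space1]) simp
  have act: "(\<lambda>p. snd (fst p)) \<in> ?P \<rightarrow>\<^sub>M action_algebra M"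
    by (intro measurable_compose[OF measurable_fst] measurable_restrict_space1 measurable_snd)
  have in_target: "Measurable.pred ?P (\<lambda>p. snd p \<in> target M)"
    by (rule measurable_compose[OF snd_borel]) (simp add: target_borel pred_def)
  have k: "(\<lambda>p. if snd p \<in> target M then return ?S (snd p, snd (fst p))
      else distr (\<pi> (Suc t) (snd p)) ?S (Pair (snd p))) \<in> ?P \<rightarrow>\<^sub>M prob_algebra ?S"
  proof (subst measurable_If_restrict_space_iff)
    let ?N = "restrict_space ?P {p. snd p \<notin> target M}"
    have st: "snd \<in> ?N \<rightarrow>\<^sub>M restrict_space borel (nontarget M)"
      by (intro measurable_restrict_space2 measurable_restrict_space1 snd_borel)
         (auto simp: space_restrict_space space_pair_measure nontarget_def)
    have st': "snd \<in> ?N \<rightarrow>\<^sub>M state_algebra M"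
      by (intro measurable_restrict_space1 measurable_snd)
    have "(\<lambda>p. distr (\<pi> (Suc t) (snd p)) ?S (Pair (snd p))) \<in> ?N \<rightarrow>\<^sub>M prob_algebra ?S"
    proof (rule measurable_distr_prob_space2[where M="action_algebra M"])
      show "(\<lambda>p. \<pi> (Suc t) (snd p)) \<in> ?N \<rightarrow>\<^sub>M prob_algebra (action_algebra M)"
        by (rule measurable_compose[OF st policyD[OF \<pi>]])
      show "(\<lambda>(p, a). (snd p, a)) \<in> ?N \<Otimes>\<^sub>M action_algebra M \<rightarrow>\<^sub>M ?S"
        unfolding split_beta'
        by (intro measurable_Pair measurable_compose[OF measurable_fst st'] measurable_snd)
    qed
    moreover have "(\<lambda>p. return ?S (snd p, snd (fst p)))
        \<in> restrict_space ?P {p. snd p \<in> target M} \<rightarrow>\<^sub>M prob_algebra ?S"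
      by (intro measurable_restrict_space1 measurable_compose[OF _ measurable_return_prob_space]
          measurable_Pair measurable_snd act)
    ultimately show "(\<lambda>p. return ?S (snd p, snd (fst p)))
        \<in> restrict_space ?P {p. snd p \<in> target M} \<rightarrow>\<^sub>M prob_algebra ?S \<and>
      (\<lambda>p. distr (\<pi> (Suc t) (snd p)) ?S (Pair (snd p))) \<in> ?N \<rightarrow>\<^sub>M prob_algebra ?S"
      by simp
  next
    show "{p \<in> space ?P. snd p \<in> target M} \<in> sets ?P"
      using in_target by (simp add: pred_def)
  qed
  have "(\<lambda>z. transition M z \<bind> (\<lambda>y. if y \<in> target M then return ?S (y, snd z)
      else distr (\<pi> (Suc t) y) ?S (Pair y))) \<in> ?G \<rightarrow>\<^sub>M prob_algebra ?S"
    by (rule measurable_bind_prob_space2[OF tr]) (use k in \<open>simp add: split_beta'\<close>)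
  moreover have "return ?S \<in> restrict_space ?S {z. z \<notin> controlled_pairs M} \<rightarrow>\<^sub>M prob_algebra ?S"
    by (intro measurable_restrict_space1 measurable_return_prob_space)
  moreover have "{z \<in> space ?S. z \<in> controlled_pairs M} \<in> sets ?S"
    using controlled_pairs_pred by (simp add: pred_def)
  ultimately show ?thesis
    unfolding step_kernel_def[abs_def] by (subst measurable_If_restrict_space_iff) auto
qed

lemma Ionescu_Tulcea_history_kernel:
  assumes \<pi>: "\<pi> \<in> policies M" and x: "x \<in> nontarget M"
  shows "Ionescu_Tulcea (history_kernel M \<pi> x) (\<lambda>_. pair_algebra M)"
proof -
  let ?S = "pair_algebra M"
  have "history_kernel M \<pi> x t \<in> PiM {0..<t} (\<lambda>_. ?S) \<rightarrow>\<^sub>M prob_algebra ?S" for t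
  proof (cases t)
    case 0
    have "x \<in> space (restrict_space borel (nontarget M))"
      using x by (simp add: space_restrict_space)
    from measurable_space[OF policyD[OF \<pi>] this]
    have "\<pi> 0 x \<in> space (prob_algebra (action_algebra M))" .
    moreover have "Pair x \<in> action_algebra M \<rightarrow>\<^sub>M ?S"
      using x by (intro measurable_Pair1') (auto simp: space_restrict_space nontarget_def)
    ultimately have "distr (\<pi> 0 x) ?S (Pair x) \<in> space (prob_algebra ?S)"
      by (auto simp: space_prob_algebra intro!: prob_space.prob_space_distr cong: measurable_cong_sets)
    then show ?thesis using 0 by simp
  next
    case (Suc n)
    then show ?thesis
      by (auto intro!: measurable_compose[OF _ step_kernel_measurable[OF \<pi>]] measurable_component_singleton)
  qed
  note * = this
  show ?thesis
  proof (rule Ionescu_Tulcea.intro)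
    fix i \<omega>
    show "history_kernel M \<pi> x i \<in> PiM {0..<i} (\<lambda>_. ?S) \<rightarrow>\<^sub>M subprob_algebra ?S"
      by (rule measurable_prob_algebraD[OF *])
    assume "\<omega> \<in> space (PiM {0..<i} (\<lambda>_. ?S))"
    from measurable_space[OF * this] show "prob_space (history_kernel M \<pi> x i \<omega>)"
      by (simp add: space_prob_algebra)
  qed
qed

end

end

theory Submission
  imports Defs
begin

text \<open>
  The value function is obtained by value iteration. Write \<open>T \<xi> x\<close> for the infimum over the
  feasible actions of the one-stage cost \<open>one_stage M \<xi> x a\<close> (the constant \<open>bellman\<close>). By the
  strong Feller property the expectation of a bounded measurable function is continuous in the
  state-action pair, so for measurable \<open>\<xi>\<close> with values in \<open>[0, \<infinity>]\<close> the one-stage cost is a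
  supremum of lower semicontinuous functions of the action. As the sets of feasible actions are
  compact, the infimum is attained, and \<open>T\<close> commutes with the increasing limit \<open>v\<close> of the iterates
  of \<open>T\<close> from zero (\<open>bellman_limit_value\<close>), so that \<open>v = T v\<close>.

  The value of a policy is the supremum of its finite-horizon values, which satisfy a backward
  recursion (\<open>policy_value_eq_SUP_horizon_value\<close>). Hence the \<open>n\<close>-th iterate is a lower bound for
  the \<open>n\<close>-stage value of every policy, and \<open>v\<close> is a lower bound for the value of every policy.
  Conversely, if \<open>\<xi>\<close> is a measurable solution of the optimality equation and \<open>f\<close> is a measurable
  selector of minimizing actions, then the stationary policy of \<open>f\<close> has value at most \<open>\<xi>\<close>
  (\<open>stationary_value_le\<close>). For \<open>\<xi> = v\<close> this shows that \<open>v\<close> is the optimal value and that \<open>f\<close> is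
  optimal; for arbitrary \<open>\<xi>\<close> it shows that the optimal value is the least solution. The equation
  for an optimal stationary policy is the fixed point equation for its own value
  (\<open>stationary_value_eq\<close>).

  The set of feasible actions is not assumed to depend semicontinuously on the state; only its
  graph is Borel. So Borel measurability of \<open>T \<xi>\<close> and of a minimizing selector rest on descriptive
  set theory: a Borel set with compact sections has a Borel projection
  (\<open>borel_projection_compact_sections\<close>) and a Borel selector (\<open>borel_selection_compact_sections\<close>).
  Both are derived from Novikov's separation theorem for sequences of analytic sets
  (\<open>novikov_separation\<close>).
\<close>

section \<open>Analytic sets in Polish spaces\<close>
instance prod :: (polish_space, polish_space) polish_space ..

text \<open>
  The Baire space: sequences of natural numbers, these carrying the discrete metric.
\<close>
type_synonym baire = "nat \<Rightarrow> nat discrete"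

lemma open_finitely_determined:
  fixes P :: "baire \<Rightarrow> bool"
  assumes "\<And>\<sigma> \<tau>. P \<sigma> \<Longrightarrow> (\<And>i. i \<le> n \<Longrightarrow> \<tau> i = \<sigma> i) \<Longrightarrow> P \<tau>"
  shows "open {\<sigma>. P \<sigma>}"
proof -
  have "open (\<Inter>i\<in>{..n}. (\<lambda>\<tau>::baire. \<tau> i) -` {\<sigma> i})" for \<sigma>
    by (intro open_INT ballI finite_atMost open_vimage open_discrete continuous_on_product_coordinates)
  then have "open (\<Union>\<sigma>\<in>{\<sigma>. P \<sigma>}. \<Inter>i\<in>{..n}. (\<lambda>\<tau>::baire. \<tau> i) -` {\<sigma> i})"
    by (intro open_UN ballI)
  also have "(\<Union>\<sigma>\<in>{\<sigma>. P \<sigma>}. \<Inter>i\<in>{..n}. (\<lambda>\<tau>::baire. \<tau> i) -` {\<sigma> i}) = {\<sigma>. P \<sigma>}"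
    using assms by auto
  finally show ?thesis .
qed

lemma continuous_finitely_determined:
  fixes f :: "baire \<Rightarrow> 'a::topological_space"
  assumes "\<And>\<sigma> \<tau>. (\<And>i. i \<le> n \<Longrightarrow> \<tau> i = \<sigma> i) \<Longrightarrow> f \<tau> = f \<sigma>"
  shows "continuous_on UNIV f"
proof (subst continuous_on_open_vimage, simp, intro allI impI)
  fix B :: "'a set"
  have "open {\<sigma>. f \<sigma> \<in> B}"
  proof (rule open_finitely_determined[of _ n])
    fix \<sigma> \<tau> assume "f \<sigma> \<in> B" "\<And>i. i \<le> n \<Longrightarrow> \<tau> i = \<sigma> i"
    with assms[of \<tau> \<sigma>] show "f \<tau> \<in> B" by simp
  qed
  then show "open (f -` B \<inter> UNIV)" by (simp add: vimage_def)
qed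

lemma geometric_convergence:
  fixes u :: "nat \<Rightarrow> 'a::complete_space"
  assumes "\<And>n. dist (u n) (u (Suc n)) \<le> (1/2)^n"
  obtains l where "u \<longlonglongrightarrow> l" "\<And>n. dist (u n) l \<le> 2 * (1/2)^n"
proof -
  have *: "dist (u m) (u (m + k)) \<le> 2 * (1/2)^m - 2 * (1/2)^(m + k)" for m k
  proof (induction k)
    case (Suc k)
    have "dist (u m) (u (m + Suc k)) \<le> dist (u m) (u (m + k)) + dist (u (m + k)) (u (Suc (m + k)))"
      by (simp add: dist_triangle)
    also have "\<dots> \<le> 2 * (1/2)^m - 2 * (1/2)^(m + k) + (1/2)^(m + k)"
      using Suc assms[of "m + k"] by linarith
    finally show ?case by simp
  qed simp
  have bd: "dist (u m) (u n) \<le> 2 * (1/2)^m" if "m \<le> n" for m n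
  proof -
    have "dist (u m) (u (m + (n - m))) \<le> 2 * (1/2)^m"
      by (rule order.trans[OF *]) simp
    then show ?thesis using that by simp
  qed
  have "Cauchy u"
  proof (rule metric_CauchyI)
    fix e :: real assume "e > 0"
    then obtain N where N: "(1/2::real)^N < e / 4"
      using real_arch_pow_inv[of "e/4" "1/2"] by auto
    have "dist (u m) (u n) < e" if "m \<ge> N" "n \<ge> N" for m n
      using bd[OF that(1)] bd[OF that(2)] N dist_triangle3[of "u m" "u n" "u N"] by linarith
    then show "\<exists>M. \<forall>m\<ge>M. \<forall>n\<ge>M. dist (u m) (u n) < e" by blast
  qed
  then obtain l where l: "u \<longlonglongrightarrow> l" using Cauchy_convergent convergentD by blast
  have "dist (u n) l \<le> 2 * (1/2)^n" for n
    by (rule tendsto_upperbound[OF tendsto_dist[OF tendsto_const l]])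
       (use bd in \<open>auto intro!: eventually_sequentiallyI[of n]\<close>)
  with l show thesis by (rule that)
qed

lemma dense_sequence_exists:
  fixes C :: "'a::{metric_space, second_countable_topology} set"
  assumes "C \<noteq> {}"
  obtains d :: "nat \<Rightarrow> 'a" where "range d \<subseteq> C" "\<And>x e. x \<in> C \<Longrightarrow> 0 < e \<Longrightarrow> \<exists>n. dist (d n) x < e"
proof -
  obtain B :: "'a set set" where B: "countable B" "topological_basis B"
    using ex_countable_basis by blast
  define B' where "B' = {b \<in> B. b \<inter> C \<noteq> {}}"
  define p where "p b = (SOME x. x \<in> b \<inter> C)" for b
  have p: "p b \<in> b \<inter> C" if "b \<in> B'" for b
    unfolding p_def by (rule someI_ex) (use that in \<open>auto simp: B'_def\<close>)
  have near: "\<exists>b\<in>B'. dist (p b) x < e" if "x \<in> C" "0 < e" for x e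
  proof -
    obtain b where b: "b \<in> B" "x \<in> b" "b \<subseteq> ball x e"
      by (rule topological_basisE[OF B(2) open_ball[of x e], of x]) (use \<open>0 < e\<close> in auto)
    with that have "b \<in> B'" by (auto simp: B'_def)
    with p[OF this] b(3) show ?thesis by (auto simp: dist_commute intro!: bexI[of _ b])
  qed
  have ne: "B' \<noteq> {}" using near[of _ 1] assms by fastforce
  have ct: "countable B'" using B(1) by (simp add: B'_def)
  show thesis
  proof
    show "range (p \<circ> from_nat_into B') \<subseteq> C"
      using p from_nat_into[OF ne] by auto
    show "\<exists>n. dist ((p \<circ> from_nat_into B') n) x < e" if "x \<in> C" "0 < e" for x e
      using near[OF that] by (metis comp_apply ct from_nat_into_to_nat_on)
  qed
qed

text \<open>
  A sequence of indices into a dense sequence \<open>d\<close> is decoded into a point: the \<open>n\<close>-th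
  approximation moves on to the next dense point if that is within distance \<open>2\<close> to the power \<open>-n\<close>,
  and stays where it is otherwise. So every sequence of indices yields a Cauchy sequence.
\<close>
lemma closed_continuous_image_baire:
  fixes C :: "'a::polish_space set"
  assumes "closed C" "C \<noteq> {}"
  obtains f :: "baire \<Rightarrow> 'a" where "continuous_on UNIV f" "range f = C"
proof -
  obtain d :: "nat \<Rightarrow> 'a" where d: "range d \<subseteq> C" "\<And>x e. x \<in> C \<Longrightarrow> 0 < e \<Longrightarrow> \<exists>n. dist (d n) x < e"
    using dense_sequence_exists[OF assms(2)] by metis
  define y :: "baire \<Rightarrow> nat \<Rightarrow> 'a" where
    "y \<sigma> = rec_nat (d (of_discrete (\<sigma> 0))) (\<lambda>n z. let w = d (of_discrete (\<sigma> (Suc n))) in if dist z w \<le> (1/2)^n then w else z)"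
    for \<sigma>
  have y0: "y \<sigma> 0 = d (of_discrete (\<sigma> 0))" for \<sigma> by (simp add: y_def)
  have yS: "y \<sigma> (Suc n) = (if dist (y \<sigma> n) (d (of_discrete (\<sigma> (Suc n)))) \<le> (1/2)^n
      then d (of_discrete (\<sigma> (Suc n))) else y \<sigma> n)" for \<sigma> n
    by (simp add: y_def Let_def)
  have step: "dist (y \<sigma> n) (y \<sigma> (Suc n)) \<le> (1/2)^n" for \<sigma> n
    by (auto simp: yS)
  have "\<exists>l. y \<sigma> \<longlonglongrightarrow> l \<and> (\<forall>n. dist (y \<sigma> n) l \<le> 2 * (1/2)^n)" for \<sigma>
    using geometric_convergence[of "y \<sigma>", OF step] by metis
  then obtain f where f: "\<And>\<sigma>. y \<sigma> \<longlonglongrightarrow> f \<sigma>" "\<And>\<sigma> n. dist (y \<sigma> n) (f \<sigma>) \<le> 2 * (1/2)^n"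
    by metis
  have det: "y \<tau> n = y \<sigma> n" if "\<And>i. i \<le> n \<Longrightarrow> \<tau> i = \<sigma> i" for \<sigma> \<tau> n
    using that by (induction n) (auto simp: y0 yS)
  have cont: "continuous_on UNIV (\<lambda>\<sigma>. y \<sigma> n)" for n
    by (rule continuous_finitely_determined[of n]) (rule det)
  have unif: "uniform_limit UNIV (\<lambda>n \<sigma>. y \<sigma> n) f sequentially"
  proof (rule uniform_limitI)
    fix e :: real assume "e > 0"
    then obtain N where N: "(1/2::real)^N < e / 2"
      using real_arch_pow_inv[of "e/2" "1/2"] by auto
    show "\<forall>\<^sub>F n in sequentially. \<forall>\<sigma>\<in>UNIV. dist (y \<sigma> n) (f \<sigma>) < e"
    proof (rule eventually_sequentiallyI[of N], intro ballI)
      fix n \<sigma> assume "N \<le> n"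
      then have "(1/2::real)^n \<le> (1/2)^N" by (intro power_decreasing) auto
      then show "dist (y \<sigma> n) (f \<sigma>) < e" using f(2)[of \<sigma> n] N by linarith
    qed
  qed
  have "continuous_on UNIV f"
    by (rule uniform_limit_theorem[OF _ unif]) (auto intro!: always_eventually cont)
  moreover have "range f = C"
  proof
    have "y \<sigma> n \<in> C" for \<sigma> n
      using d(1) by (induction n) (auto simp: y0 yS)
    then show "range f \<subseteq> C"
      using closed_sequentially[OF assms(1) _ f(1)] by auto
    show "C \<subseteq> range f"
    proof
      fix x assume x: "x \<in> C"
      have "\<exists>k. \<forall>n. dist (d (k n)) x < (1/2)^n / 4"
        by (intro choice allI d(2)[OF x]) simp
      then obtain k where k: "\<And>n. dist (d (k n)) x < (1/2)^n / 4" by blast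
      define \<sigma> where "\<sigma> n = discrete (k n)" for n
      have \<sigma>: "of_discrete (\<sigma> n) = k n" for n by (simp add: \<sigma>_def discrete_inverse)
      have y_eq: "y \<sigma> n = d (k n)" for n
      proof (induction n)
        case (Suc n)
        have "dist (d (k n)) (d (k (Suc n))) \<le> dist (d (k n)) x + dist (d (k (Suc n))) x"
          by (rule dist_triangle2)
        also have "\<dots> \<le> (1/2)^n"
          using k[of n] k[of "Suc n"] zero_le_power[of "1/2::real" n] unfolding power_Suc by linarith
        finally show ?case by (simp add: yS Suc \<sigma>)
      qed (simp add: y0 \<sigma>)
      have "(\<lambda>n. d (k n)) \<longlonglongrightarrow> x"
      proof (rule metric_LIMSEQ_I)
        fix e :: real assume "e > 0"
        then obtain N where N: "(1/2::real)^N < e"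
          using real_arch_pow_inv[of "e" "1/2"] by auto
        have "dist (d (k n)) x < e" if "n \<ge> N" for n
        proof -
          have "(1/2::real)^n \<le> (1/2)^N" using that by (intro power_decreasing) auto
          moreover have "0 \<le> (1/2::real)^n" by simp
          ultimately show ?thesis using k[of n] N by linarith
        qed
        then show "\<exists>no. \<forall>n\<ge>no. dist (d (k n)) x < e" by blast
      qed
      moreover have "y \<sigma> = (\<lambda>n. d (k n))" using y_eq by (rule ext)
      ultimately have "y \<sigma> \<longlonglongrightarrow> x" by simp
      then have "f \<sigma> = x" using f(1) LIMSEQ_unique by blast
      then show "x \<in> range f" by blast
    qed
  qed
  ultimately show thesis by (rule that)
qed

text \<open>
  A set is analytic if it is the projection of a closed subset of its product with the Baire
  space. By \<open>analytic_continuous_image_baire\<close> and \<open>analytic_range_baire\<close> this is the same as being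
  empty or a continuous image of the Baire space; unlike that description, the definition does not
  single out the empty set.
\<close>
definition analytic :: "'a::polish_space set \<Rightarrow> bool" where
  "analytic A \<longleftrightarrow> (\<exists>C :: ('a \<times> baire) set. closed C \<and> A = fst ` C)"

lemma analytic_closed:
  assumes "closed A" shows "analytic A"
  unfolding analytic_def
proof (intro exI conjI)
  show "closed (A \<times> (UNIV :: baire set))" using assms by (intro closed_Times closed_UNIV)
  show "A = fst ` (A \<times> (UNIV :: baire set))" by simp
qed

lemma analytic_continuous_image_baire:
  assumes "analytic A" "A \<noteq> {}"
  obtains f :: "baire \<Rightarrow> 'a::polish_space" where "continuous_on UNIV f" "range f = A"
proof -
  obtain C :: "('a \<times> baire) set" where C: "closed C" "A = fst ` C"
    using assms(1) by (auto simp: analytic_def)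
  with assms(2) have "C \<noteq> {}" by auto
  then obtain g :: "baire \<Rightarrow> 'a \<times> baire" where g: "continuous_on UNIV g" "range g = C"
    using closed_continuous_image_baire[OF C(1)] by metis
  show thesis
  proof
    show "continuous_on UNIV (fst \<circ> g)" using g(1) by (intro continuous_on_compose continuous_on_fst) auto
    show "range (fst \<circ> g) = A" using g(2) C(2) by auto
  qed
qed

lemma analytic_range_baire:
  fixes f :: "baire \<Rightarrow> 'a::polish_space"
  assumes "continuous_on UNIV f" shows "analytic (range f)"
  unfolding analytic_def
proof (intro exI conjI)
  have "continuous_on UNIV (\<lambda>p::'a \<times> baire. f (snd p))"
    by (rule continuous_on_compose2[OF assms]) (auto intro: continuous_intros)
  then show "closed {p. fst p = f (snd p)}"
    by (intro closed_Collect_eq continuous_intros)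
  show "range f = fst ` {p. fst p = f (snd p)}"
  proof (intro equalityI subsetI)
    fix x assume "x \<in> range f"
    then obtain \<sigma> where "x = f \<sigma>" by blast
    then show "x \<in> fst ` {p. fst p = f (snd p)}"
      by (intro image_eqI[of _ _ "(f \<sigma>, \<sigma>)"]) auto
  qed auto
qed

lemma analytic_image:
  fixes h :: "'a::polish_space \<Rightarrow> 'b::polish_space"
  assumes "analytic A" "continuous_on UNIV h" shows "analytic (h ` A)"
proof (cases "A = {}")
  case True
  then show ?thesis by (simp add: analytic_closed)
next
  case False
  then obtain f :: "baire \<Rightarrow> 'a" where f: "continuous_on UNIV f" "range f = A"
    using analytic_continuous_image_baire[OF assms(1)] by metis
  have "analytic (range (\<lambda>\<sigma>. h (f \<sigma>)))"
    by (intro analytic_range_baire continuous_on_compose2[OF assms(2) f(1)]) auto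
  also have "range (\<lambda>\<sigma>. h (f \<sigma>)) = h ` A" using f(2) by auto
  finally show ?thesis .
qed

lemma analytic_vimage:
  fixes h :: "'a::polish_space \<Rightarrow> 'b::polish_space"
  assumes "analytic A" "continuous_on UNIV h" shows "analytic (h -` A)"
proof -
  obtain C :: "('b \<times> baire) set" where C: "closed C" "A = fst ` C"
    using assms(1) by (auto simp: analytic_def)
  have "continuous_on UNIV (\<lambda>p::'a \<times> baire. (h (fst p), snd p))"
    by (intro continuous_on_Pair continuous_on_compose2[OF assms(2)] continuous_intros) auto
  then have "closed ((\<lambda>p. (h (fst p), snd p)) -` C)"
    using C(1) by (rule closed_vimage[rotated])
  moreover have "h -` A = fst ` ((\<lambda>p. (h (fst p), snd p)) -` C)"
  proof (intro equalityI subsetI)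
    fix x assume "x \<in> h -` A"
    then obtain \<sigma> where "(h x, \<sigma>) \<in> C" using C(2) by auto
    then show "x \<in> fst ` ((\<lambda>p. (h (fst p), snd p)) -` C)"
      by (intro image_eqI[of _ _ "(x, \<sigma>)"]) auto
  next
    fix x assume "x \<in> fst ` ((\<lambda>p. (h (fst p), snd p)) -` C)"
    then obtain \<sigma> where "(h x, \<sigma>) \<in> C" by auto
    then show "x \<in> h -` A" using C(2) by (auto intro: image_eqI[of _ fst "(h x, \<sigma>)"])
  qed
  ultimately show ?thesis unfolding analytic_def by blast
qed

lemma analytic_INT:
  fixes A :: "nat \<Rightarrow> 'a::polish_space set"
  assumes "\<And>n. analytic (A n)" shows "analytic (\<Inter>n. A n)"
proof -
  have "\<exists>C. \<forall>n. closed (C n) \<and> A n = fst ` (C n :: ('a \<times> baire) set)"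
    using assms unfolding analytic_def by (intro choice) auto
  then obtain C :: "nat \<Rightarrow> ('a \<times> baire) set" where C: "\<And>n. closed (C n)" "\<And>n. A n = fst ` C n"
    by blast
  define g where "g n = (\<lambda>p::'a \<times> baire. (fst p, (\<lambda>k. snd p (prod_encode (n, k)))))" for n
  have "continuous_on UNIV (g n)" for n
    unfolding g_def
    by (intro continuous_intros continuous_on_product_then_coordinatewise[of _ "\<lambda>p. snd p"])
  then have cl: "closed (\<Inter>n. g n -` C n)"
    using C(1) by (intro closed_INT ballI closed_vimage)
  have "(\<Inter>n. A n) = fst ` (\<Inter>n. g n -` C n)"
  proof
    show "(\<Inter>n. A n) \<subseteq> fst ` (\<Inter>n. g n -` C n)"
    proof
      fix x assume "x \<in> (\<Inter>n. A n)"
      then have "\<forall>n. \<exists>\<sigma>. (x, \<sigma>) \<in> C n" using C(2) by fastforce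
      then obtain s where s: "\<And>n. (x, s n) \<in> C n" by metis
      \<comment> \<open>One sequence codes the countably many witnesses, through the pairing function.\<close>
      define \<sigma> :: baire where "\<sigma> m = (case prod_decode m of (n, k) \<Rightarrow> s n k)" for m
      have "(\<lambda>k. \<sigma> (prod_encode (n, k))) = s n" for n by (simp add: \<sigma>_def)
      then have "(x, \<sigma>) \<in> (\<Inter>n. g n -` C n)" using s by (simp add: g_def)
      then show "x \<in> fst ` (\<Inter>n. g n -` C n)" by force
    qed
    show "fst ` (\<Inter>n. g n -` C n) \<subseteq> (\<Inter>n. A n)"
      unfolding C(2) by (force simp: g_def)
  qed
  with cl show ?thesis unfolding analytic_def by blast
qed

lemma analytic_UN:
  fixes A :: "nat \<Rightarrow> 'a::polish_space set"
  assumes "\<And>n. analytic (A n)" shows "analytic (\<Union>n. A n)"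
proof -
  have "\<exists>C. \<forall>n. closed (C n) \<and> A n = fst ` (C n :: ('a \<times> baire) set)"
    using assms unfolding analytic_def by (intro choice) auto
  then obtain C :: "nat \<Rightarrow> ('a \<times> baire) set" where C: "\<And>n. closed (C n)" "\<And>n. A n = fst ` C n"
    by blast
  define g where "g = (\<lambda>p::'a \<times> baire. (fst p, (\<lambda>k. snd p (Suc k))))"
  have coord: "continuous_on UNIV (\<lambda>p::'a \<times> baire. snd p k)" for k
    by (intro continuous_on_product_then_coordinatewise[of _ "\<lambda>p. snd p"] continuous_intros)
  have cg: "continuous_on UNIV g"
    unfolding g_def by (intro continuous_intros coord)
  \<comment> \<open>The first entry of the code selects the set of the union, the remaining ones are its witness.\<close>
  define E where "E = {p. g p \<in> C (of_discrete (snd p 0))}"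
  have "open ((\<lambda>p::'a \<times> baire. snd p 0) -` {discrete n} \<inter> g -` (- C n))" for n
    by (intro open_Int open_vimage[OF open_discrete coord] open_vimage[OF _ cg]) (use C(1) in auto)
  then have "open (\<Union>n. (\<lambda>p::'a \<times> baire. snd p 0) -` {discrete n} \<inter> g -` (- C n))" by blast
  moreover have "(\<Union>n. (\<lambda>p::'a \<times> baire. snd p 0) -` {discrete n} \<inter> g -` (- C n)) = - E"
    unfolding E_def by (auto simp: discrete_inverse of_discrete_inverse)
  ultimately have "closed E" by (simp add: closed_def)
  moreover have "(\<Union>n. A n) = fst ` E"
  proof
    show "(\<Union>n. A n) \<subseteq> fst ` E"
    proof
      fix x assume "x \<in> (\<Union>n. A n)"
      then obtain n \<sigma> where "(x, \<sigma>) \<in> C n" using C(2) by fastforce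
      then have "(x, case_nat (discrete n) \<sigma>) \<in> E"
        by (simp add: E_def g_def discrete_inverse)
      then show "x \<in> fst ` E" by force
    qed
    show "fst ` E \<subseteq> (\<Union>n. A n)"
      unfolding C(2) E_def g_def by (force simp: image_iff)
  qed
  ultimately show ?thesis unfolding analytic_def by blast
qed

lemma analytic_Int:
  assumes "analytic A" "analytic B" shows "analytic (A \<inter> B)"
proof -
  have "analytic (\<Inter>n. if n = (0::nat) then A else B)"
    using assms by (intro analytic_INT) auto
  also have "(\<Inter>n. if n = (0::nat) then A else B) = A \<inter> B"
    by (auto split: if_splits)
  finally show ?thesis .
qed

lemma analytic_Un:
  assumes "analytic A" "analytic B" shows "analytic (A \<union> B)"
proof -
  have "analytic (\<Union>n. if n = (0::nat) then A else B)"
    using assms by (intro analytic_UN) auto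
  also have "(\<Union>n. if n = (0::nat) then A else B) = A \<union> B"
    by (auto split: if_splits)
  finally show ?thesis .
qed

lemma analytic_open:
  fixes A :: "'a::polish_space set"
  assumes "open A" shows "analytic A"
proof -
  obtain F :: "nat \<Rightarrow> 'a set" where F: "\<And>n. closed (F n)" "A = (\<Union>n. F n)"
  proof (cases "A = UNIV")
    case True
    then show thesis by (intro that[of "\<lambda>_. UNIV"]) auto
  next
    case False
    show thesis
    proof
      show "closed {x. inverse (Suc n) \<le> infdist x (- A)}" for n
        by (intro closed_Collect_le continuous_intros)
      have "x \<in> A \<longleftrightarrow> 0 < infdist x (- A)" for x
      proof -
        have "closed (- A)" "- A \<noteq> {}" using assms False by auto
        from in_closed_iff_infdist_zero[OF this, of x] show ?thesis
          using infdist_nonneg[of x "- A"] by auto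
      qed
      moreover have "0 < infdist x (- A) \<longleftrightarrow> (\<exists>n. inverse (Suc n) \<le> infdist x (- A))" for x
      proof
        assume "0 < infdist x (- A)"
        then show "\<exists>n. inverse (Suc n) \<le> infdist x (- A)"
          using reals_Archimedean less_imp_le by blast
      next
        assume "\<exists>n. inverse (Suc n) \<le> infdist x (- A)"
        then obtain n where "inverse (Suc n) \<le> infdist x (- A)" by blast
        moreover have "0 < inverse (real (Suc n))" by simp
        ultimately show "0 < infdist x (- A)" by linarith
      qed
      ultimately show "A = (\<Union>n. {x. inverse (Suc n) \<le> infdist x (- A)})" by blast
    qed
  qed
  show ?thesis unfolding F(2) by (intro analytic_UN analytic_closed F(1))
qed

text \<open>
  The sets that are analytic together with their complement form a \<open>\<sigma>\<close>-algebra, which contains the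
  open sets.
\<close>
lemma analytic_borel:
  fixes A :: "'a::polish_space set"
  assumes "A \<in> sets borel" shows "analytic A"
proof -
  have "A \<in> sigma_sets UNIV {S. open S}"
    using assms by (simp add: borel_def)
  then have "analytic A \<and> analytic (- A)"
  proof induction
    case (Basic a)
    then show ?case by (auto intro: analytic_open analytic_closed)
  next
    case Empty
    then show ?case by (auto intro: analytic_closed)
  next
    case (Compl a)
    then show ?case by (simp add: Compl_eq_Diff_UNIV[symmetric])
  next
    case (Union a)
    then show ?case by (auto simp: Compl_UN intro!: analytic_UN analytic_INT)
  qed
  then show ?thesis ..
qed

section \<open>Novikov separation\<close>

text \<open>
  Dependent choice for properties \<open>Q m\<close> that only depend on the first \<open>m\<close> entries of a sequence.
\<close>
lemma sequence_from_extensions: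
  fixes Q :: "nat \<Rightarrow> (nat \<Rightarrow> 'b) \<Rightarrow> bool"
  assumes init: "Q 0 z0"
    and local: "\<And>m z z'. Q m z \<Longrightarrow> (\<And>i. i < m \<Longrightarrow> z' i = z i) \<Longrightarrow> Q m z'"
    and step: "\<And>m z. Q m z \<Longrightarrow> \<exists>i. Q (Suc m) (z(m := i))"
  obtains z where "\<And>m. Q m z"
proof -
  have "\<exists>F. \<forall>n. Q n (F n) \<and> (\<exists>i. F (Suc n) = (F n)(n := i))"
    by (rule dependent_nat_choice) (use init step in blast)+
  then obtain F where F: "\<And>n. Q n (F n)" "\<And>n. \<exists>i. F (Suc n) = (F n)(n := i)" by metis
  have eq: "F (Suc n + k) n = F (Suc n) n" for n k
  proof (induction k)
    case (Suc k)
    obtain i where "F (Suc (Suc n + k)) = (F (Suc n + k))(Suc n + k := i)" using F(2) by blast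
    then show ?case using Suc by simp
  qed simp
  have "Q m (\<lambda>n. F (Suc n) n)" for m
  proof (rule local[OF F(1)[of m]])
    fix i assume "i < m"
    then obtain k where "m = Suc i + k" using less_iff_Suc_add by auto
    then show "F (Suc i) i = F m i" using eq[of i k] by simp
  qed
  then show thesis by (rule that)
qed

text \<open>
  A sequence of sets is called Borel separable if its members are contained in Borel sets with
  empty intersection. For two sets (the others being the whole space) this is the usual notion.
\<close>
definition borel_separable :: "(nat \<Rightarrow> 'a::topological_space set) \<Rightarrow> bool" where
  "borel_separable A \<longleftrightarrow> (\<exists>B. (\<forall>n. B n \<in> sets borel \<and> A n \<subseteq> B n) \<and> (\<Inter>n. B n) = {})"

lemma borel_separable_UN:
  fixes A :: "nat \<Rightarrow> 'a::topological_space set" and S :: "'i::countable \<Rightarrow> 'a set"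
  assumes "\<And>i. borel_separable (A(n := S i))"
  shows "borel_separable (A(n := (\<Union>i. S i)))"
proof -
  have "\<forall>i. \<exists>B. (\<forall>m. B m \<in> sets borel \<and> (A(n := S i)) m \<subseteq> B m) \<and> (\<Inter>m. B m) = {}"
    using assms by (auto simp: borel_separable_def)
  then obtain B where B: "\<And>i m. B i m \<in> sets borel" "\<And>i m. (A(n := S i)) m \<subseteq> B i m"
    "\<And>i. (\<Inter>m. B i m) = {}" by metis
  define B' where "B' m = (if m = n then \<Union>i. B i n else \<Inter>i. B i m)" for m
  have "B' m \<in> sets borel" for m
    using B(1) by (auto simp: B'_def intro!: sets.countable_UN'' sets.countable_INT'')
  moreover have "(A(n := (\<Union>i. S i))) m \<subseteq> B' m" for m
  proof (cases "m = n")
    case True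
    with B(2)[of _ n] show ?thesis by (force simp: B'_def)
  next
    case False
    have "A m \<subseteq> B i m" for i using B(2)[of i m] False by simp
    with False show ?thesis by (auto simp: B'_def)
  qed
  moreover have "(\<Inter>m. B' m) = {}"
  proof -
    have False if x: "\<And>m. x \<in> B' m" for x
    proof -
      from x[of n] obtain i where i: "x \<in> B i n" by (auto simp: B'_def)
      have "x \<in> B i m" for m
        using i x[of m] by (cases "m = n") (auto simp: B'_def)
      then show False using B(3)[of i] by auto
    qed
    then show ?thesis by auto
  qed
  ultimately show ?thesis unfolding borel_separable_def by blast
qed

lemma borel_separable_disjoint_open:
  fixes A :: "nat \<Rightarrow> 'a::topological_space set"
  assumes "open U" "open V" "U \<inter> V = {}" "A i \<subseteq> U" "A j \<subseteq> V" "i \<noteq> j"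
  shows "borel_separable A"
  unfolding borel_separable_def
proof (intro exI conjI allI)
  let ?B = "\<lambda>n. if n = i then U else if n = j then V else UNIV"
  show "?B n \<in> sets borel" "A n \<subseteq> ?B n" for n
    using assms by auto
  have "(\<Inter>n. ?B n) \<subseteq> ?B i \<inter> ?B j" by blast
  then show "(\<Inter>n. ?B n) = {}" using assms by auto
qed

text \<open>
  Analytic sets with empty intersection are Borel separable. Each \<open>A n\<close> is a continuous image of
  the Baire space under some \<open>f n\<close>. If separation failed, then by \<open>borel_separable_UN\<close> it would
  fail after fixing one more entry of the argument of one of the \<open>f n\<close>, and so on forever, which
  determines points \<open>y n\<close> of the Baire space. The values \<open>f n (y n)\<close> cannot all agree. Two of them
  that differ have disjoint neighbourhoods, which separate as soon as enough entries are fixed, by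
  continuity.
\<close>
theorem novikov_separation:
  fixes A :: "nat \<Rightarrow> 'a::polish_space set"
  assumes "\<And>n. analytic (A n)" "(\<Inter>n. A n) = {}"
  obtains B where "\<And>n. B n \<in> sets borel" "\<And>n. A n \<subseteq> B n" "(\<Inter>n. B n) = {}"
proof (cases "\<exists>n. A n = {}")
  case True
  then obtain n where "A n = {}" by blast
  then show thesis by (intro that[of "\<lambda>m. if m = n then {} else UNIV"]) (auto split: if_splits)
next
  case False
  then have "\<forall>n. \<exists>f :: baire \<Rightarrow> 'a. continuous_on UNIV f \<and> range f = A n"
    using analytic_continuous_image_baire assms(1) by metis
  then obtain f :: "nat \<Rightarrow> baire \<Rightarrow> 'a" where f: "\<And>n. continuous_on UNIV (f n)" "\<And>n. range (f n) = A n"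
    by metis
  \<comment> \<open>All arguments are coded in one sequence \<open>z\<close>: entry \<open>k\<close> of the argument of \<open>f n\<close> is entry
     \<open>prod_encode (n, k)\<close> of \<open>z\<close>, and fixing \<open>m\<close> entries of \<open>z\<close> leaves the images \<open>S m z n\<close>.\<close>
  define S where "S m z n = f n ` {\<sigma>. \<forall>k. prod_encode (n, k) < m \<longrightarrow> \<sigma> k = z (prod_encode (n, k))}"
    for m and z :: baire and n
  have "borel_separable A"
  proof (rule ccontr)
    assume non: "\<not> borel_separable A"
    obtain z where z: "\<And>m. \<not> borel_separable (S m z)"
    proof (rule sequence_from_extensions[where Q="\<lambda>m z. \<not> borel_separable (S m z)"])
      show "\<not> borel_separable (S 0 (\<lambda>_. discrete 0))"
        using non f(2) by (simp add: S_def[abs_def])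
    next
      fix m z z' assume "\<not> borel_separable (S m z)" "\<And>i. i < m \<Longrightarrow> z' i = z i"
      moreover from this(2) have "S m z' = S m z"
        unfolding S_def by (intro ext image_cong Collect_cong) auto
      ultimately show "\<not> borel_separable (S m z')" by simp
    next
      fix m z assume *: "\<not> borel_separable (S m z)"
      obtain n k where nk: "m = prod_encode (n, k)" by (metis prod.exhaust prod_decode_inverse)
      define T where "T i = S (Suc m) (z(m := i)) n" for i
      have "S (Suc m) (z(m := i)) = (S m z)(n := T i)" for i
      proof
        fix n'
        show "S (Suc m) (z(m := i)) n' = ((S m z)(n := T i)) n'"
        proof (cases "n' = n")
          case False
          then have "prod_encode (n', k') \<noteq> m" for k' by (simp add: nk)
          then show ?thesis using False by (auto simp: S_def less_Suc_eq intro!: image_cong)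
        qed (simp add: T_def)
      qed
      moreover have "S m z n = (\<Union>i. T i)"
      proof -
        have "{\<sigma>. \<forall>k'. prod_encode (n, k') < m \<longrightarrow> \<sigma> k' = z (prod_encode (n, k'))} =
          (\<Union>i. {\<sigma>. \<forall>k'. prod_encode (n, k') < Suc m \<longrightarrow> \<sigma> k' = (z(m := i)) (prod_encode (n, k'))})"
          by (auto simp: less_Suc_eq nk)
        then show ?thesis unfolding T_def S_def by (simp add: image_UN[symmetric])
      qed
      then have "\<not> borel_separable ((S m z)(n := (\<Union>i. T i)))" using * by (metis fun_upd_triv)
      then have "\<exists>i. \<not> borel_separable ((S m z)(n := T i))" using borel_separable_UN by blast
      ultimately show "\<exists>i. \<not> borel_separable (S (Suc m) (z(m := i)))" by simp
    qed blast
    define y :: "nat \<Rightarrow> baire" where "y n = (\<lambda>k. z (prod_encode (n, k)))" for n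
    have "\<exists>i j. f i (y i) \<noteq> f j (y j)"
    proof (rule ccontr)
      assume "\<not> ?thesis"
      then have "f 0 (y 0) \<in> A n" for n using f(2)[of n] by (metis rangeI)
      then show False using assms(2) by auto
    qed
    then obtain i j where ij: "f i (y i) \<noteq> f j (y j)" by blast
    then obtain U V where UV: "open U" "open V" "f i (y i) \<in> U" "f j (y j) \<in> V" "U \<inter> V = {}"
      by (metis hausdorff)
    have near: "\<exists>M. \<forall>m\<ge>M. S m z n \<subseteq> U" if U: "open U" "f n (y n) \<in> U" for n and U :: "'a set"
    proof -
      have "open (f n -` U)" using f(1) U(1) by (rule open_vimage[rotated])
      then have "openin (product_topology (\<lambda>_. euclidean) UNIV) (f n -` U)"
        by (simp add: open_fun_def)
      from product_topology_open_contains_basis[OF this, of "y n"] U(2)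
      obtain X where X: "finite {i. X i \<noteq> UNIV}" "y n \<in> PiE UNIV X" "PiE UNIV X \<subseteq> f n -` U"
        by auto
      obtain M where M: "\<And>k. X k \<noteq> UNIV \<Longrightarrow> prod_encode (n, k) < M"
        using finite_imageI[OF X(1), of "\<lambda>k. prod_encode (n, k)"]
        by (auto simp: finite_nat_iff_bounded)
      have "S m z n \<subseteq> U" if "m \<ge> M" for m
      proof -
        have "\<sigma> \<in> PiE UNIV X" if \<sigma>: "\<forall>k. prod_encode (n, k) < m \<longrightarrow> \<sigma> k = z (prod_encode (n, k))" for \<sigma>
        proof -
          have "\<sigma> k \<in> X k" for k
          proof (cases "X k = UNIV")
            case False
            then have "\<sigma> k = y n k" using M[of k] \<sigma> \<open>m \<ge> M\<close> by (auto simp: y_def)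
            then show ?thesis using X(2) by auto
          qed simp
          then show ?thesis by auto
        qed
        then show ?thesis using X(3) unfolding S_def by blast
      qed
      then show ?thesis by blast
    qed
    obtain M1 M2 where "\<forall>m\<ge>M1. S m z i \<subseteq> U" "\<forall>m\<ge>M2. S m z j \<subseteq> V"
      using near[OF UV(1,3)] near[OF UV(2,4)] by blast
    then have "S (max M1 M2) z i \<subseteq> U" "S (max M1 M2) z j \<subseteq> V" by auto
    with UV ij have "borel_separable (S (max M1 M2) z)"
      by (intro borel_separable_disjoint_open[of U V _ i j]) auto
    with z show False by blast
  qed
  with that show thesis unfolding borel_separable_def by blast
qed

corollary lusin_separation:
  fixes A C :: "'a::polish_space set"
  assumes "analytic A" "analytic C" "A \<inter> C = {}"
  obtains B where "B \<in> sets borel" "A \<subseteq> B" "B \<inter> C = {}"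
proof -
  define S where "S n = (if n = (0::nat) then A else C)" for n
  have "analytic (S n)" for n using assms by (simp add: S_def)
  moreover have "(\<Inter>n. S n) \<subseteq> S 0 \<inter> S 1" by blast
  then have "(\<Inter>n. S n) = {}" using assms by (simp add: S_def)
  ultimately obtain B where B: "\<And>n. B n \<in> sets borel" "\<And>n. S n \<subseteq> B n" "(\<Inter>n. B n) = {}"
    using novikov_separation[of S] by metis
  have "C \<subseteq> B n" if "n > 0" for n using B(2)[of n] that by (simp add: S_def)
  then have "B 0 \<inter> C \<subseteq> (\<Inter>n. B n)" by (metis INT_greatest Int_lower1 gr0I le_infI2)
  moreover have "A \<subseteq> B 0" using B(2)[of 0] by (simp add: S_def)
  ultimately show thesis using B by (intro that[of "B 0"]) auto
qed

section \<open>Borel sets with compact sections\<close>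

text \<open>
  The argument of Kunugui and Novikov. The complement of \<open>D\<close> has open sections, and it is the
  union of the rectangles \<open>X n \<times> V n\<close>, where the \<open>V n\<close> form a base and \<open>X n\<close> is the coanalytic set
  of points whose section misses \<open>V n\<close>. Novikov separation shrinks the \<open>X n\<close> to Borel sets \<open>B n\<close>
  without losing the union. By compactness of \<open>K\<close>, a section of \<open>D\<close> is empty iff finitely many of
  the rectangles cover \<open>K\<close> over that point, which is a Borel condition.
\<close>
lemma borel_projection_closed_sections:
  fixes D :: "('a::polish_space \<times> 'b::polish_space) set" and K :: "'b set"
  assumes D: "analytic D" "analytic (- D)"
    and K: "compact K"
    and sections: "\<And>x. closed {y. (x, y) \<in> D}" "\<And>x y. (x, y) \<in> D \<Longrightarrow> y \<in> K"
  shows "fst ` D \<in> sets borel"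
proof -
  obtain V :: "nat \<Rightarrow> 'b set" where V: "\<And>n. open (V n)"
    "\<And>U y. open U \<Longrightarrow> y \<in> U \<Longrightarrow> \<exists>n. y \<in> V n \<and> V n \<subseteq> U"
  proof -
    obtain BB :: "'b set set" where BB: "countable BB" "topological_basis BB"
      using ex_countable_basis by blast
    have ne: "BB \<noteq> {}"
      using topological_basisE[OF BB(2) open_UNIV UNIV_I] by blast
    show thesis
    proof
      show "open (from_nat_into BB n)" for n
        using from_nat_into[OF ne] topological_basis_open[OF BB(2)] by blast
      show "\<exists>n. y \<in> from_nat_into BB n \<and> from_nat_into BB n \<subseteq> U" if "open U" "y \<in> U" for U y
        using topological_basisE[OF BB(2) that] from_nat_into_surj[OF BB(1)] by metis
    qed
  qed
  define X where "X n = - fst ` (D \<inter> (UNIV \<times> V n))" for n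
  have aX: "analytic (- X n)" for n
    unfolding X_def double_compl
    by (intro analytic_image analytic_Int D analytic_open open_Times V open_UNIV continuous_intros)
  have X_sub: "(x, y) \<notin> D" if "x \<in> X n" "y \<in> V n" for x y n
    using that by (force simp: X_def)
  \<comment> \<open>\<open>E n\<close> is the complement of the rectangle \<open>X n \<times> V n\<close>.\<close>
  define E where "E n = fst -` (- X n) \<union> (UNIV \<times> (- V n))" for n
  have aE: "analytic (- D \<inter> E n)" for n
    unfolding E_def
    by (intro analytic_Int analytic_Un analytic_vimage aX D analytic_closed closed_Times closed_UNIV
        continuous_intros) (use V in auto)
  have "(\<Inter>n. - D \<inter> E n) = {}"
  proof -
    have False if "(x, y) \<notin> D" "\<And>n. (x, y) \<in> E n" for x y
    proof -
      obtain n where n: "y \<in> V n" "V n \<subseteq> - {y. (x, y) \<in> D}"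
        using V(2)[of "- {y. (x, y) \<in> D}" y] sections(1)[of x] \<open>(x, y) \<notin> D\<close> by auto
      then have "x \<in> X n" by (auto simp: X_def)
      with n(1) that(2)[of n] show False by (simp add: E_def)
    qed
    then show ?thesis by auto
  qed
  then obtain W where W: "\<And>n. W n \<in> sets borel" "\<And>n. - D \<inter> E n \<subseteq> W n" "(\<Inter>n. W n) = {}"
    using novikov_separation[of "\<lambda>n. - D \<inter> E n"] aE by metis
  have "\<exists>B. B \<in> sets borel \<and> fst ` (- D \<inter> - W n) \<subseteq> B \<and> B \<subseteq> X n" for n
  proof -
    have "fst ` (- D \<inter> - W n) \<inter> - X n = {}"
      using W(2)[of n] by (auto simp: E_def)
    moreover have "analytic (fst ` (- D \<inter> - W n))"
      by (intro analytic_image analytic_Int D analytic_borel continuous_intros) (use W(1)[of n] in simp)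
    ultimately obtain B where "B \<in> sets borel" "fst ` (- D \<inter> - W n) \<subseteq> B" "B \<inter> - X n = {}"
      using lusin_separation[OF _ aX[of n]] by metis
    then show ?thesis by blast
  qed
  then obtain B where B: "\<And>n. B n \<in> sets borel" "\<And>n. fst ` (- D \<inter> - W n) \<subseteq> B n" "\<And>n. B n \<subseteq> X n"
    by metis
  have O_eq: "(x, y) \<notin> D \<longleftrightarrow> (\<exists>n. x \<in> B n \<and> y \<in> V n)" for x y
  proof
    assume xy: "(x, y) \<notin> D"
    obtain n where n: "(x, y) \<notin> W n" using W(3) by blast
    with xy have "x \<in> B n" using B(2)[of n] by force
    moreover have "(x, y) \<notin> E n" using W(2)[of n] n xy by blast
    then have "y \<in> V n" by (simp add: E_def)
    ultimately show "\<exists>n. x \<in> B n \<and> y \<in> V n" by blast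
  next
    assume "\<exists>n. x \<in> B n \<and> y \<in> V n"
    then show "(x, y) \<notin> D" using B(3) X_sub by blast
  qed
  have "- fst ` D = (\<Union>F\<in>{F. finite F \<and> K \<subseteq> (\<Union>n\<in>F. V n)}. \<Inter>n\<in>F. B n)" (is "_ = ?R")
  proof (intro equalityI subsetI)
    fix x assume "x \<in> - fst ` D"
    then have "K \<subseteq> (\<Union>n\<in>{n. x \<in> B n}. V n)"
      using O_eq by force
    then obtain F where "F \<subseteq> {n. x \<in> B n}" "finite F" "K \<subseteq> (\<Union>n\<in>F. V n)"
      using compactE_image[OF K, of "{n. x \<in> B n}" V] V(1) by metis
    then show "x \<in> ?R" by blast
  next
    fix x assume "x \<in> ?R"
    then obtain F where F: "K \<subseteq> (\<Union>n\<in>F. V n)" "x \<in> (\<Inter>n\<in>F. B n)" by blast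
    have "(x, y) \<notin> D" for y
    proof (cases "y \<in> K")
      case True
      with F show ?thesis using O_eq by blast
    qed (use sections(2) in blast)
    then show "x \<in> - fst ` D" by auto
  qed
  moreover have "?R \<in> sets borel"
  proof (rule sets.countable_UN')
    show "countable {F. finite F \<and> K \<subseteq> (\<Union>n\<in>F. V n)}"
      by (rule countable_subset[OF _ countable_Collect_finite]) auto
    have "(\<Inter>n\<in>F. B n) \<in> sets borel" if "finite F" for F
      using that B(1) by (cases "F = {}") (auto intro!: sets.finite_INT)
    then show "(\<lambda>F. \<Inter>n\<in>F. B n) ` {F. finite F \<and> K \<subseteq> (\<Union>n\<in>F. V n)} \<subseteq> sets borel"
      by auto
  qed
  ultimately have "- fst ` D \<in> sets borel" by simp
  then show ?thesis by (metis borel_comp double_complement)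
qed

text \<open>
  A point is mapped to its distances to the points of a dense sequence, cut off at \<open>1\<close>. By
  completeness the image consists of all \<open>z\<close> with arbitrarily small entries that satisfy the
  triangle inequalities \<open>\<bar>z m - min 1 (dist (d n) (d m))\<bar> \<le> z n\<close>, hence it is Borel.
\<close>
lemma embedding_into_cube:
  obtains h :: "'a::polish_space \<Rightarrow> nat \<Rightarrow> real" where
    "continuous_on UNIV h" "inj h" "\<And>y n. h y n \<in> {0..1}" "range h \<in> sets borel"
proof -
  obtain d :: "nat \<Rightarrow> 'a" where d: "\<And>x e. 0 < e \<Longrightarrow> \<exists>n. dist (d n) x < e"
    using dense_sequence_exists[of "UNIV :: 'a set"] by (metis UNIV_I UNIV_not_empty)
  define h where "h y n = min 1 (dist (d n) y)" for y n
  define H where "H = {z::nat \<Rightarrow> real. (\<forall>k. \<exists>n. z n < (1/2)^k) \<and>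
    (\<forall>m n. \<bar>z m - min 1 (dist (d n) (d m))\<bar> \<le> z n)}"
  have cont: "continuous_on UNIV h"
    unfolding h_def[abs_def] by (intro continuous_on_coordinatewise_then_product continuous_intros)
  have h_H: "h y \<in> H" for y
  proof -
    have "\<exists>n. h y n < (1/2)^k" for k
      using d[of "(1/2)^k" y] by (auto simp: h_def min_less_iff_disj)
    moreover have "\<bar>h y m - min 1 (dist (d n) (d m))\<bar> \<le> h y n" for m n
      using dist_triangle[of "d n" "d m" y] dist_triangle3[of "d n" y "d m"]
        dist_triangle3[of "d m" y "d n"] dist_commute[of "d n" "d m"]
        dist_triangle2[of "d n" "d m" y] zero_le_dist[of "d n" y] zero_le_dist[of "d m" y]
        zero_le_dist[of "d n" "d m"] dist_commute[of "d n" y] dist_commute[of "d m" y]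
      unfolding h_def by linarith
    ultimately show ?thesis by (simp add: H_def)
  qed
  have point: "\<exists>y. \<forall>m. z m = h y m" if z: "z \<in> H" for z
  proof -
    have tri: "\<bar>z m - min 1 (dist (d n) (d m))\<bar> \<le> z n" for m n using z by (simp add: H_def)
    have "\<forall>k. \<exists>n. z n < (1/2)^(k+2)" using z unfolding H_def by blast
    then obtain N where N: "\<And>k. z (N k) < (1/2)^(k+2)" by metis
    have "dist (d (N k)) (d (N (Suc k))) \<le> (1/2)^k" for k
    proof -
      have "min 1 (dist (d (N k)) (d (N (Suc k)))) \<le> z (N k) + z (N (Suc k))"
        using tri[of "N (Suc k)" "N k"] by linarith
      also have "\<dots> < (1/2)^(k+2) + (1/2)^(Suc k+2)" using N[of k] N[of "Suc k"] by linarith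
      also have "\<dots> \<le> (1/2)^k" by simp
      finally have "min 1 (dist (d (N k)) (d (N (Suc k)))) < (1/2)^k" .
      moreover have "(1/2::real)^k \<le> 1" by (simp add: power_le_one)
      ultimately show ?thesis by linarith
    qed
    then obtain y where y: "(\<lambda>k. d (N k)) \<longlonglongrightarrow> y"
      using geometric_convergence[of "\<lambda>k. d (N k)"] by metis
    have z0: "(\<lambda>k. z (N k)) \<longlonglongrightarrow> 0"
    proof (rule tendsto_sandwich)
      show "\<forall>\<^sub>F k in sequentially. 0 \<le> z (N k)"
        using tri by (intro always_eventually allI) (meson abs_ge_zero order.trans)
      show "\<forall>\<^sub>F k in sequentially. z (N k) \<le> (1/2)^(k+2)"
        using N by (intro always_eventually allI less_imp_le)
      show "(\<lambda>k. (1/2::real)^(k+2)) \<longlonglongrightarrow> 0"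
        by (rule LIMSEQ_ignore_initial_segment[OF LIMSEQ_realpow_zero]) auto
    qed simp
    have "z m = h y m" for m
    proof -
      have "(\<lambda>k. min 1 (dist (d (N k)) (d m))) \<longlonglongrightarrow> min 1 (dist y (d m))"
        by (intro tendsto_intros y)
      moreover have "(\<lambda>k. min 1 (dist (d (N k)) (d m))) \<longlonglongrightarrow> z m"
      proof (rule LIM_zero_cancel, rule Lim_null_comparison[OF _ z0])
        show "\<forall>\<^sub>F k in sequentially. norm (min 1 (dist (d (N k)) (d m)) - z m) \<le> z (N k)"
          using tri[of m] by (intro always_eventually allI) (simp add: abs_minus_commute)
      qed
      ultimately show ?thesis using LIMSEQ_unique by (auto simp: h_def dist_commute)
    qed
    then show ?thesis by blast
  qed
  have "range h = H"
    using h_H point by (auto intro!: ext simp: image_iff fun_eq_iff)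
  moreover have "H \<in> sets borel"
  proof -
    have "open {z::nat \<Rightarrow> real. z n < (1/2)^k}" for n k
      by (intro open_Collect_less continuous_intros continuous_on_product_coordinates)
    moreover have "closed {z::nat \<Rightarrow> real. \<bar>z m - min 1 (dist (d n) (d m))\<bar> \<le> z n}" for m n
      by (intro closed_Collect_le continuous_intros continuous_on_product_coordinates)
    ultimately have "(\<Inter>k. \<Union>n. {z::nat \<Rightarrow> real. z n < (1/2)^k}) \<inter>
      (\<Inter>m. \<Inter>n. {z. \<bar>z m - min 1 (dist (d n) (d m))\<bar> \<le> z n}) \<in> sets borel"
      by (intro sets.Int sets.countable_INT'' sets.countable_UN'' UNIV_I) (auto intro: borel_open borel_closed)
    also have "(\<Inter>k. \<Union>n. {z::nat \<Rightarrow> real. z n < (1/2)^k}) \<inter>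
      (\<Inter>m. \<Inter>n. {z. \<bar>z m - min 1 (dist (d n) (d m))\<bar> \<le> z n}) = H"
      by (auto simp: H_def)
    finally show ?thesis .
  qed
  moreover have "inj h"
  proof (rule injI, rule ccontr)
    fix y y' assume eq: "h y = h y'" and "y \<noteq> y'"
    define e where "e = min 1 (dist y y' / 2)"
    have "0 < e" using \<open>y \<noteq> y'\<close> by (simp add: e_def)
    then obtain n where n: "dist (d n) y < e" using d by blast
    have "min 1 (dist (d n) y) = min 1 (dist (d n) y')" using eq by (auto simp: h_def fun_eq_iff)
    then have "dist (d n) y' < e" using n unfolding e_def by linarith
    with n have "dist y y' < 2 * e" using dist_triangle3[of y y' "d n"] by linarith
    then show False unfolding e_def by linarith
  qed
  ultimately show thesis
    by (intro that[of h] cont) (auto simp: h_def)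
qed

text \<open>
  Embedding the second factor into the cube makes the sections subsets of one compact set. The
  image of \<open>D\<close> is analytic, and so is its complement because the range of the embedding is Borel.
\<close>
theorem borel_projection_compact_sections:
  fixes D :: "('a::polish_space \<times> 'b::polish_space) set"
  assumes D: "D \<in> sets borel" and sections: "\<And>x. compact {y. (x, y) \<in> D}"
  shows "fst ` D \<in> sets borel"
proof -
  obtain h :: "'b \<Rightarrow> nat \<Rightarrow> real" where h: "continuous_on UNIV h" "inj h" "\<And>y n. h y n \<in> {0..1}"
    "range h \<in> sets borel"
    using embedding_into_cube by blast
  define g where "g = (\<lambda>p::'a \<times> 'b. (fst p, h (snd p)))"
  have g: "continuous_on UNIV g"
    unfolding g_def by (intro continuous_on_Pair continuous_on_compose2[OF h(1)] continuous_intros) auto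
  have "fst ` g ` D \<in> sets borel"
  proof (rule borel_projection_closed_sections)
    show "analytic (g ` D)" by (intro analytic_image analytic_borel D g)
    have "- g ` D = g ` (- D) \<union> snd -` (- range h)"
    proof (intro equalityI subsetI)
      fix p assume p: "p \<in> - g ` D"
      show "p \<in> g ` (- D) \<union> snd -` (- range h)"
      proof (cases "snd p \<in> range h")
        case True
        then obtain y where "snd p = h y" by blast
        then have "p = g (fst p, y)" by (simp add: g_def prod_eq_iff)
        with p show ?thesis by blast
      qed simp
    next
      fix p assume "p \<in> g ` (- D) \<union> snd -` (- range h)"
      then show "p \<in> - g ` D" using h(2) by (auto simp: g_def inj_eq)
    qed
    moreover have "analytic (g ` (- D) \<union> snd -` (- range h))"
      by (intro analytic_Un analytic_image analytic_vimage analytic_borel g continuous_intros)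
         (use D h(4) in auto)
    ultimately show "analytic (- g ` D)" by simp
    have "compactin (product_topology (\<lambda>_. euclidean) UNIV) (PiE UNIV (\<lambda>_::nat. {0..1::real}))"
      by (subst compactin_PiE) simp
    then show "compact (PiE UNIV (\<lambda>_::nat. {0..1::real}))"
      by (simp add: euclidean_product_topology)
    show "z \<in> PiE UNIV (\<lambda>_. {0..1})" if "(x, z) \<in> g ` D" for x z
      using that h(3) by (auto simp: g_def)
    show "closed {z. (x, z) \<in> g ` D}" for x
    proof -
      have "{z. (x, z) \<in> g ` D} = h ` {y. (x, y) \<in> D}" by (force simp: g_def)
      moreover have "compact (h ` {y. (x, y) \<in> D})"
        by (intro compact_continuous_image sections continuous_on_subset[OF h(1)]) auto
      ultimately show ?thesis by (simp add: compact_imp_closed)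
    qed
  qed
  also have "fst ` g ` D = fst ` D" by (simp add: g_def image_image)
  finally show ?thesis .
qed

lemma compact_decseq_nonempty:
  fixes F :: "nat \<Rightarrow> 'a::t2_space set"
  assumes "\<And>n. compact (F n)" "\<And>n. F n \<noteq> {}" "\<And>n. F (Suc n) \<subseteq> F n"
  shows "(\<Inter>n. F n) \<noteq> {}"
proof -
  have dec: "F n \<subseteq> F m" if "m \<le> n" for m n
    using lift_Suc_antimono_le[of F, OF assms(3) that] .
  have "F 0 \<inter> (\<Inter>n\<in>UNIV. F n) \<noteq> {}"
  proof (rule compact_imp_fip_image[OF assms(1)])
    show "closed (F n)" for n using assms(1) by (rule compact_imp_closed)
    show "F 0 \<inter> (\<Inter>n\<in>I. F n) \<noteq> {}" if "finite I" for I
    proof -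
      have "F (Max (insert 0 I)) \<subseteq> F 0 \<inter> (\<Inter>n\<in>I. F n)"
        using that by (intro Int_greatest INT_greatest dec) auto
      then show ?thesis using assms(2) by blast
    qed
  qed
  then show ?thesis by blast
qed

text \<open>
  The sections are cut down successively by closed balls of radius \<open>2\<close> to the power \<open>-m\<close> around
  points of a dense sequence, always taking the first ball that meets the current section. The
  choice is Borel by the projection theorem, and by compactness a point remains in the limit; it
  is the limit of the chosen centres.
\<close>
theorem borel_selection_compact_sections:
  fixes D :: "('a::polish_space \<times> 'b::polish_space) set"
  assumes D: "D \<in> sets borel" and sections: "\<And>x. compact {y. (x, y) \<in> D}"
  obtains f where "f \<in> borel_measurable (restrict_space borel (fst ` D))"
    "\<And>x. x \<in> fst ` D \<Longrightarrow> (x, f x) \<in> D"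
proof -
  obtain d :: "nat \<Rightarrow> 'b" where d: "\<And>x e. 0 < e \<Longrightarrow> \<exists>n. dist (d n) x < e"
    using dense_sequence_exists[of "UNIV :: 'b set"] by (metis UNIV_I UNIV_not_empty)
  define cut where "cut E m k = E \<inter> UNIV \<times> cball (d k) ((1/2)^m)" for E :: "('a \<times> 'b) set" and m k
  define pick where "pick E m x = (LEAST k. x \<in> fst ` cut E m k)" for E m x
  define refine where "refine m E = {p \<in> E. p \<in> cut E m (pick E m (fst p))}" for m E
  define E where "E = rec_nat D refine"
  have E0: "E 0 = D" and ES: "E (Suc m) = refine m (E m)" for m by (simp_all add: E_def)
  have pick: "x \<in> fst ` cut E m (pick E m x)" if x: "x \<in> fst ` E" for E m x
  proof -
    obtain y where y: "(x, y) \<in> E" using x by auto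
    obtain k where "dist (d k) y < (1/2)^m" using d[of "(1/2)^m" y] by auto
    then have "(x, y) \<in> cut E m k" using y by (simp add: cut_def)
    then have "x \<in> fst ` cut E m k" by force
    then show ?thesis unfolding pick_def by (rule LeastI)
  qed
  have fst_refine: "fst ` refine m E = fst ` E" for m E
  proof (intro equalityI subsetI)
    fix x assume "x \<in> fst ` E"
    from pick[OF this, of m] obtain y where "(x, y) \<in> cut E m (pick E m x)" by auto
    then have "(x, y) \<in> refine m E" by (simp add: refine_def cut_def)
    then show "x \<in> fst ` refine m E" by force
  qed (auto simp: refine_def)
  have sec_refine: "{y. (x, y) \<in> refine m E} = {y. (x, y) \<in> E} \<inter> cball (d (pick E m x)) ((1/2)^m)" for x m E
    by (auto simp: refine_def cut_def)
  have cut_borel: "fst ` cut E m k \<in> sets borel"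
    if "E \<in> sets borel" "\<And>x. compact {y. (x, y) \<in> E}" for E m k
  proof (rule borel_projection_compact_sections)
    show "cut E m k \<in> sets borel"
      unfolding cut_def
      by (intro sets.Int that borel_closed closed_Times closed_UNIV closed_cball)
    have "{y. (x, y) \<in> cut E m k} = {y. (x, y) \<in> E} \<inter> cball (d k) ((1/2)^m)" for x
      by (auto simp: cut_def)
    then show "compact {y. (x, y) \<in> cut E m k}" for x
      using that(2) by (simp add: compact_Int_closed)
  qed
  have refine_borel: "refine m E \<in> sets borel"
    if E: "E \<in> sets borel" "\<And>x. compact {y. (x, y) \<in> E}" for E m
  proof -
    let ?P = "\<lambda>k. fst ` cut E m k - (\<Union>j<k. fst ` cut E m j)"
    have "refine m E = (\<Union>k. cut E m k \<inter> fst -` ?P k)"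
    proof (intro equalityI subsetI)
      fix p assume p: "p \<in> refine m E"
      let ?k = "pick E m (fst p)"
      have "p \<in> cut E m ?k" using p by (simp add: refine_def)
      moreover have "fst p \<notin> fst ` cut E m j" if "j < ?k" for j
        using that unfolding pick_def by (rule not_less_Least)
      ultimately show "p \<in> (\<Union>k. cut E m k \<inter> fst -` ?P k)" by blast
    next
      fix p assume "p \<in> (\<Union>k. cut E m k \<inter> fst -` ?P k)"
      then obtain k where k: "p \<in> cut E m k" "fst p \<in> ?P k" by blast
      have "pick E m (fst p) = k"
        unfolding pick_def using k(2) by (intro Least_equality) (auto simp: not_less[symmetric])
      with k(1) show "p \<in> refine m E" by (simp add: refine_def cut_def)
    qed
    moreover have "fst -` ?P k \<in> sets (borel :: ('a \<times> 'b) measure)" for k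
    proof -
      have "?P k \<in> sets borel"
        by (intro sets.Diff sets.finite_UN cut_borel[OF E]) auto
      then have "fst -` ?P k \<inter> space borel \<in> sets (borel :: ('a \<times> 'b) measure)"
        by (intro measurable_sets[OF borel_measurable_continuous_onI] continuous_intros)
      then show ?thesis by simp
    qed
    moreover have "cut E m k \<in> sets borel" for k
      unfolding cut_def by (intro sets.Int that borel_closed closed_Times closed_UNIV closed_cball)
    ultimately show ?thesis by auto
  qed
  have inv: "E m \<in> sets borel \<and> (\<forall>x. compact {y. (x, y) \<in> E m}) \<and> fst ` E m = fst ` D" for m
  proof (induction m)
    case 0
    show ?case using D sections by (simp add: E0)
  next
    case (Suc m)
    then show ?case
      by (auto simp: ES fst_refine sec_refine intro!: refine_borel compact_Int_closed)
  qed
  have "\<exists>y. \<forall>m. (x, y) \<in> E m" if "x \<in> fst ` D" for x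
  proof -
    have "(\<Inter>m. {y. (x, y) \<in> E m}) \<noteq> {}"
    proof (rule compact_decseq_nonempty)
      show "compact {y. (x, y) \<in> E m}" for m using inv by blast
      have "x \<in> fst ` E m" for m using inv that by simp
      then show "{y. (x, y) \<in> E m} \<noteq> {}" for m by force
      show "{y. (x, y) \<in> E (Suc m)} \<subseteq> {y. (x, y) \<in> E m}" for m
        by (auto simp: ES refine_def)
    qed
    then show ?thesis by blast
  qed
  then obtain f where f: "\<And>x m. x \<in> fst ` D \<Longrightarrow> (x, f x) \<in> E m" by metis
  have close: "dist (d (pick (E m) m x)) (f x) \<le> (1/2)^m" if "x \<in> fst ` D" for x m
    using f[OF that, of "Suc m"] by (simp add: ES refine_def cut_def)
  show thesis
  proof
    show "f \<in> borel_measurable (restrict_space borel (fst ` D))"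
    proof (rule borel_measurable_LIMSEQ_metric)
      fix m
      have "{x. x \<in> fst ` cut (E m) m k} \<in> sets borel" for k
        using cut_borel inv by simp
      then have "(\<lambda>x. x \<in> fst ` cut (E m) m k) \<in> borel \<rightarrow>\<^sub>M count_space UNIV" for k
        by (simp add: pred_def)
      then have "pick (E m) m \<in> borel \<rightarrow>\<^sub>M count_space UNIV"
        unfolding pick_def[abs_def] by (rule measurable_Least)
      then have "(\<lambda>x. d (pick (E m) m x)) \<in> borel_measurable borel"
        by (rule measurable_compose) simp
      then show "(\<lambda>x. d (pick (E m) m x)) \<in> borel_measurable (restrict_space borel (fst ` D))"
        by (rule measurable_restrict_space1)
    next
      fix x assume "x \<in> space (restrict_space borel (fst ` D))"
      then have x: "x \<in> fst ` D" by (simp add: space_restrict_space)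
      show "(\<lambda>m. d (pick (E m) m x)) \<longlonglongrightarrow> f x"
      proof (rule metric_LIMSEQ_I)
        fix e :: real assume "e > 0"
        then obtain N where N: "(1/2::real)^N < e"
          using real_arch_pow_inv[of "e" "1/2"] by auto
        have "dist (d (pick (E m) m x)) (f x) < e" if "m \<ge> N" for m
        proof -
          have "(1/2::real)^m \<le> (1/2)^N" using that by (intro power_decreasing) auto
          then show ?thesis using close[OF x, of m] N by linarith
        qed
        then show "\<exists>no. \<forall>m\<ge>no. dist (d (pick (E m) m x)) (f x) < e" by blast
      qed
    qed
    show "(x, f x) \<in> D" if "x \<in> fst ` D" for x
      using f[OF that, of 0] by (simp add: E0)
  qed
qed

section \<open>The value of a policy as a limit of finite-horizon values\<close>
context Ionescu_Tulcea
begin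

lemma CI_initial_segment: "CI {0..<n} = C 0 n (\<lambda>_. undefined)"
proof -
  have "up_to {0..<n} \<le> k \<longleftrightarrow> n \<le> k" for k
    using up_to_iff_Ico[of "{0..<n}" k] by auto
  then have "up_to {0..<n} = n" by (meson order.antisym order.refl)
  then show ?thesis
    using distr_C[of n n "\<lambda>_. undefined" 0] by (simp add: CI_def)
qed

lemma nn_integral_lim_C:
  assumes f: "f \<in> borel_measurable (PiM {0..<n} M)"
  shows "(\<integral>\<^sup>+\<omega>. f (restrict \<omega> {0..<n}) \<partial>PF.lim) = (\<integral>\<^sup>+\<omega>. f \<omega> \<partial>C 0 n (\<lambda>_. undefined))"
proof -
  have "(\<integral>\<^sup>+\<omega>. f \<omega> \<partial>C 0 n (\<lambda>_. undefined)) =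
      (\<integral>\<^sup>+\<omega>. f \<omega> \<partial>distr PF.lim (PiM {0..<n} M) (\<lambda>\<omega>. restrict \<omega> {0..<n}))"
    by (subst distr_lim) (simp_all add: CI_initial_segment)
  also have "\<dots> = (\<integral>\<^sup>+\<omega>. f (restrict \<omega> {0..<n}) \<partial>PF.lim)"
  proof (rule nn_integral_distr)
    show "(\<lambda>\<omega>. restrict \<omega> {0..<n}) \<in> PF.lim \<rightarrow>\<^sub>M PiM {0..<n} M"
      by (auto simp: measurable_cong_sets[OF PF.sets_lim refl] intro!: measurable_restrict measurable_component_singleton)
  qed (use f in simp)
  finally show ?thesis ..
qed

lemma emeasure_lim_space: "emeasure PF.lim (space PF.lim) = 1"
proof -
  have "(\<integral>\<^sup>+\<omega>. 1 \<partial>PF.lim) = (\<integral>\<^sup>+\<omega>. 1 \<partial>C 0 0 (\<lambda>_. undefined))"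
    by (rule nn_integral_lim_C) simp
  also have "\<dots> = 1"
    using prob_space.emeasure_space_1[OF prob_space_C[of "\<lambda>_. undefined" 0 0]] by simp
  finally show ?thesis by simp
qed

text \<open>
  The law of the first \<open>n + 1\<close> coordinates arises from that of the first \<open>n\<close> by one step of the
  kernel.
\<close>
lemma nn_integral_lim_step:
  assumes f: "f \<in> borel_measurable (PiM {0..<Suc n} M)"
  shows "(\<integral>\<^sup>+\<omega>. f (restrict \<omega> {0..<Suc n}) \<partial>PF.lim) =
    (\<integral>\<^sup>+\<omega>. (\<integral>\<^sup>+w. f ((restrict \<omega> {0..<n})(n := w)) \<partial>P n (restrict \<omega> {0..<n})) \<partial>PF.lim)"
proof -
  let ?u = "\<lambda>_::nat. undefined :: 'a"
  have u: "?u \<in> space (PiM {0..<0} M)" by simp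
  have meas: "(\<lambda>\<omega>. \<integral>\<^sup>+w. f w \<partial>eP n \<omega>) \<in> borel_measurable (PiM {0..<n} M)"
    by (rule measurable_compose[OF measurable_eP nn_integral_measurable_subprob_algebra[OF f]])
  have stC: "sets (C 0 n ?u) = sets (PiM {0..<n} M)" using sets_C[OF u, of n] by simp
  have "(\<integral>\<^sup>+\<omega>. f (restrict \<omega> {0..<Suc n}) \<partial>PF.lim) = (\<integral>\<^sup>+\<omega>. f \<omega> \<partial>C 0 (Suc n) ?u)"
    by (rule nn_integral_lim_C[OF f])
  also have "\<dots> = (\<integral>\<^sup>+\<omega>. (\<integral>\<^sup>+w. f w \<partial>eP n \<omega>) \<partial>C 0 n ?u)"
    unfolding C.simps
    by (subst nn_integral_bind[OF f]) (simp_all add: measurable_cong_sets[OF stC refl])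
  also have "\<dots> = (\<integral>\<^sup>+\<omega>. (\<integral>\<^sup>+w. f w \<partial>eP n (restrict \<omega> {0..<n})) \<partial>PF.lim)"
    by (rule nn_integral_lim_C[OF meas, symmetric])
  also have "\<dots> = (\<integral>\<^sup>+\<omega>. (\<integral>\<^sup>+w. f ((restrict \<omega> {0..<n})(n := w)) \<partial>P n (restrict \<omega> {0..<n})) \<partial>PF.lim)"
  proof (rule nn_integral_cong)
    fix \<omega> assume "\<omega> \<in> space PF.lim"
    then have "\<omega> \<in> space (PiM UNIV M)" using sets_eq_imp_space_eq[OF PF.sets_lim] by simp
    then have "restrict \<omega> {0..<n} \<in> space (PiM {0..<n} M)"
      by (auto simp: space_PiM PiE_iff)
    then show "(\<integral>\<^sup>+w. f w \<partial>eP n (restrict \<omega> {0..<n})) =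
        (\<integral>\<^sup>+w. f ((restrict \<omega> {0..<n})(n := w)) \<partial>P n (restrict \<omega> {0..<n}))"
      by (rule nn_integral_eP[OF _ f])
  qed
  finally show ?thesis .
qed

end

context control_model
begin

lemma sets_transition: "z \<in> controlled_pairs M \<Longrightarrow> sets (transition M z) = sets (state_algebra M)"
  using measurable_space[OF transition_kernel, of z]
  by (auto simp: space_restrict_space space_prob_algebra controlled_pairs_def feasible_pairs_def nontarget_def)

lemma prob_space_transition: "z \<in> controlled_pairs M \<Longrightarrow> prob_space (transition M z)"
  using measurable_space[OF transition_kernel, of z]
  by (auto simp: space_restrict_space space_prob_algebra controlled_pairs_def feasible_pairs_def nontarget_def)

lemma less_hitting_time_iff:
  "enat i < hitting_time M' \<omega> \<longleftrightarrow> (\<forall>j\<le>i. fst (\<omega> j) \<notin> target M')"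
proof
  assume lt: "enat i < hitting_time M' \<omega>"
  show "\<forall>j\<le>i. fst (\<omega> j) \<notin> target M'"
  proof (intro allI impI notI)
    fix j assume "j \<le> i" "fst (\<omega> j) \<in> target M'"
    then have "hitting_time M' \<omega> \<le> enat j" unfolding hitting_time_def by (intro Inf_lower) auto
    then show False using lt \<open>j \<le> i\<close> by (meson enat_ord_simps(1) leD order.trans)
  qed
next
  assume "\<forall>j\<le>i. fst (\<omega> j) \<notin> target M'"
  then have "enat (Suc i) \<le> hitting_time M' \<omega>"
    unfolding hitting_time_def by (intro Inf_greatest) (auto simp: not_less_eq_eq[symmetric])
  then show "enat i < hitting_time M' \<omega>" by (meson enat_ord_simps(2) lessI less_le_trans)
qed

text \<open>
  The cost extended by zero outside the controlled pairs. It is measurable on the whole product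
  space, whereas \<open>cost\<close> is arbitrary outside the controlled pairs.
\<close>
definition stage_cost :: "'s \<times> 'a \<Rightarrow> ennreal" where
  "stage_cost z = (if z \<in> controlled_pairs M then ennreal (cost M z) else 0)"

lemma controlled_pairs_borel: "controlled_pairs M \<in> sets borel"
proof -
  have "fst -` nontarget M \<inter> space borel \<in> sets (borel :: ('s \<times> 'a) measure)"
    by (intro measurable_sets[OF borel_measurable_continuous_onI] continuous_intros nontarget_borel)
  moreover have "controlled_pairs M = feasible_pairs M \<inter> (fst -` nontarget M \<inter> space borel)"
    by (auto simp: controlled_pairs_def feasible_pairs_def nontarget_def)
  ultimately show ?thesis using feasible_pairs_borel by simp
qed

lemma stage_cost_measurable: "stage_cost \<in> borel_measurable (pair_algebra M)"
proof -
  have "(\<lambda>z. ennreal (cost M z)) \<in> borel_measurable (restrict_space borel (controlled_pairs M))"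
    using cost_measurable by measurable
  then have "(\<lambda>z. ennreal (cost M z) * indicator (controlled_pairs M) z) \<in> borel_measurable borel"
    by (subst (asm) borel_measurable_restrict_space_iff_ennreal) (simp_all add: controlled_pairs_borel)
  also have "(\<lambda>z. ennreal (cost M z) * indicator (controlled_pairs M) z) = stage_cost"
    by (auto simp: stage_cost_def fun_eq_iff)
  finally show ?thesis by (rule measurable_compose[OF id_pair_algebra])
qed

text \<open>
  The expected cost of the stage \<open>t + i\<close> given the pair at time \<open>t\<close>, under the policy \<open>\<pi>\<close>.
\<close>
primrec expected_stage_cost :: "(nat \<Rightarrow> 's \<Rightarrow> 'a measure) \<Rightarrow> nat \<Rightarrow> nat \<Rightarrow> 's \<times> 'a \<Rightarrow> ennreal" where
  "expected_stage_cost \<pi> 0 t = stage_cost"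
| "expected_stage_cost \<pi> (Suc i) t = (\<lambda>z. \<integral>\<^sup>+w. expected_stage_cost \<pi> i (Suc t) w \<partial>step_kernel M \<pi> t z)"

text \<open>
  The expected discounted cost of the first \<open>n\<close> stages when the policy is started at time \<open>t\<close>, by
  backward recursion. The time \<open>t\<close> selects the decision kernels; discounting begins at \<open>t\<close>.
\<close>
primrec horizon_value :: "(nat \<Rightarrow> 's \<Rightarrow> 'a measure) \<Rightarrow> nat \<Rightarrow> nat \<Rightarrow> 's \<Rightarrow> ennreal" where
  "horizon_value \<pi> 0 t = (\<lambda>x. 0)"
| "horizon_value \<pi> (Suc n) t = (\<lambda>x. \<integral>\<^sup>+a. one_stage M (horizon_value \<pi> n (Suc t)) x a \<partial>\<pi> t x)"

context
  fixes \<pi>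
  assumes \<pi>: "\<pi> \<in> policies M"
begin

lemma component_measurable:
  assumes x: "x \<in> nontarget M"
  shows "(\<lambda>\<omega>. \<omega> t) \<in> trajectory M \<pi> x \<rightarrow>\<^sub>M pair_algebra M"
proof -
  interpret IT: Ionescu_Tulcea "history_kernel M \<pi> x" "\<lambda>_. pair_algebra M"
    by (rule Ionescu_Tulcea_history_kernel[OF \<pi> x])
  show ?thesis
    unfolding trajectory_def by (simp add: measurable_cong_sets[OF IT.PF.sets_lim refl] measurable_component_singleton)
qed

lemma sets_policy: "y \<in> nontarget M \<Longrightarrow> sets (\<pi> t y) = sets (action_algebra M)"
  using measurable_space[OF policyD[OF \<pi>], of y t]
  by (simp add: space_restrict_space space_prob_algebra)

lemma trajectory_initial:
  assumes x: "x \<in> nontarget M" and g: "g \<in> borel_measurable (pair_algebra M)"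
  shows "(\<integral>\<^sup>+\<omega>. g (\<omega> 0) \<partial>trajectory M \<pi> x) = (\<integral>\<^sup>+a. g (x, a) \<partial>\<pi> 0 x)"
proof -
  interpret IT: Ionescu_Tulcea "history_kernel M \<pi> x" "\<lambda>_. pair_algebra M"
    by (rule Ionescu_Tulcea_history_kernel[OF \<pi> x])
  have "(\<lambda>\<omega>. g (\<omega> 0)) \<in> borel_measurable (PiM {0..<Suc 0} (\<lambda>_. pair_algebra M))"
    by (rule measurable_compose[OF _ g], rule measurable_component_singleton) simp
  from IT.nn_integral_lim_step[OF this]
  have "(\<integral>\<^sup>+\<omega>. g (\<omega> 0) \<partial>trajectory M \<pi> x) =
      (\<integral>\<^sup>+\<omega>. (\<integral>\<^sup>+w. g w \<partial>distr (\<pi> 0 x) (pair_algebra M) (Pair x)) \<partial>trajectory M \<pi> x)"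
    by (simp add: trajectory_def)
  also have "\<dots> = (\<integral>\<^sup>+w. g w \<partial>distr (\<pi> 0 x) (pair_algebra M) (Pair x))"
    using IT.emeasure_lim_space by (simp add: trajectory_def del: IT.PF.space_lim)
  also have "\<dots> = (\<integral>\<^sup>+a. g (x, a) \<partial>\<pi> 0 x)"
  proof (rule nn_integral_distr)
    show "Pair x \<in> \<pi> 0 x \<rightarrow>\<^sub>M pair_algebra M"
      using x by (subst measurable_cong_sets[OF sets_policy[OF x] refl])
        (auto intro!: measurable_Pair1' simp: space_restrict_space nontarget_def)
  qed (use g in simp)
  finally show ?thesis .
qed

lemma trajectory_step:
  assumes x: "x \<in> nontarget M" and g: "g \<in> borel_measurable (pair_algebra M \<Otimes>\<^sub>M pair_algebra M)"
  shows "(\<integral>\<^sup>+\<omega>. g (\<omega> t, \<omega> (Suc t)) \<partial>trajectory M \<pi> x) =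
    (\<integral>\<^sup>+\<omega>. (\<integral>\<^sup>+w. g (\<omega> t, w) \<partial>step_kernel M \<pi> t (\<omega> t)) \<partial>trajectory M \<pi> x)"
proof -
  interpret IT: Ionescu_Tulcea "history_kernel M \<pi> x" "\<lambda>_. pair_algebra M"
    by (rule Ionescu_Tulcea_history_kernel[OF \<pi> x])
  have "(\<lambda>\<omega>. g (\<omega> t, \<omega> (Suc t))) \<in> borel_measurable (PiM {0..<Suc (Suc t)} (\<lambda>_. pair_algebra M))"
    by (rule measurable_compose[OF _ g], intro measurable_Pair measurable_component_singleton) simp_all
  from IT.nn_integral_lim_step[OF this] show ?thesis
    by (simp add: trajectory_def)
qed

lemma prob_space_policy: "y \<in> nontarget M \<Longrightarrow> prob_space (\<pi> t y)"
  using measurable_space[OF policyD[OF \<pi>], of y t]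
  by (simp add: space_restrict_space space_prob_algebra)

lemma AE_policy:
  assumes "y \<in> nontarget M" shows "AE a in \<pi> t y. a \<in> feasible M y"
proof -
  interpret prob_space "\<pi> t y" using assms by (rule prob_space_policy)
  have e: "emeasure (\<pi> t y) (feasible M y) = 1" using \<pi> assms by (simp add: policies_def)
  then have "feasible M y \<in> sets (\<pi> t y)"
    using emeasure_notin_sets by fastforce
  then show ?thesis using e by (simp add: AE_in_set_eq_1 emeasure_eq_measure)
qed

lemma action_measurable_Pair:
  assumes "y \<in> nontarget M" shows "Pair y \<in> \<pi> t y \<rightarrow>\<^sub>M pair_algebra M"
  using assms by (subst measurable_cong_sets[OF sets_policy[OF assms] refl])
    (auto intro!: measurable_Pair1' simp: space_restrict_space nontarget_def)

lemma arrival_kernel_measurable: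
  assumes a: "a \<in> actions M"
  shows "(\<lambda>y. if y \<in> target M then return (pair_algebra M) (y, a)
      else distr (\<pi> t y) (pair_algebra M) (Pair y)) \<in> state_algebra M \<rightarrow>\<^sub>M prob_algebra (pair_algebra M)"
proof (subst measurable_If_restrict_space_iff)
  have "Measurable.pred (state_algebra M) (\<lambda>y. y \<in> target M)"
    by (intro measurable_restrict_space1) (simp add: target_borel pred_def)
  then show "{y \<in> space (state_algebra M). y \<in> target M} \<in> sets (state_algebra M)"
    by (simp add: pred_def)
next
  let ?N = "restrict_space (state_algebra M) {y. y \<notin> target M}"
  have st: "(\<lambda>y. y) \<in> ?N \<rightarrow>\<^sub>M state_algebra M"
    by (rule measurable_restrict_space1) simp
  have "(\<lambda>y. y) \<in> ?N \<rightarrow>\<^sub>M borel"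
    by (rule measurable_compose[OF st measurable_restrict_space1]) simp
  then have "(\<lambda>y. y) \<in> ?N \<rightarrow>\<^sub>M restrict_space borel (nontarget M)"
    by (intro measurable_restrict_space2) (auto simp: space_restrict_space nontarget_def)
  then have "(\<lambda>y. distr (\<pi> t y) (pair_algebra M) (Pair y)) \<in> ?N \<rightarrow>\<^sub>M prob_algebra (pair_algebra M)"
  proof (intro measurable_distr_prob_space2[where M="action_algebra M"] measurable_compose[OF _ policyD[OF \<pi>]])
    show "(\<lambda>(y, a). (y, a)) \<in> ?N \<Otimes>\<^sub>M action_algebra M \<rightarrow>\<^sub>M pair_algebra M"
      unfolding split_beta' by (intro measurable_Pair measurable_compose[OF measurable_fst st] measurable_snd)
  qed
  moreover have "(\<lambda>y. return (pair_algebra M) (y, a))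
      \<in> restrict_space (state_algebra M) {y. y \<in> target M} \<rightarrow>\<^sub>M prob_algebra (pair_algebra M)"
    using a by (intro measurable_restrict_space1 measurable_compose[OF measurable_Pair2' measurable_return_prob_space])
      (simp add: space_restrict_space)
  ultimately show "(\<lambda>y. return (pair_algebra M) (y, a))
      \<in> restrict_space (state_algebra M) {y. y \<in> target M} \<rightarrow>\<^sub>M prob_algebra (pair_algebra M) \<and>
    (\<lambda>y. distr (\<pi> t y) (pair_algebra M) (Pair y)) \<in> ?N \<rightarrow>\<^sub>M prob_algebra (pair_algebra M)" by simp
qed

lemma nn_integral_step_kernel_controlled:
  assumes z: "z \<in> controlled_pairs M" and g: "g \<in> borel_measurable (pair_algebra M)"
  shows "(\<integral>\<^sup>+w. g w \<partial>step_kernel M \<pi> t z) =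
    (\<integral>\<^sup>+y. (if y \<in> target M then g (y, snd z) else \<integral>\<^sup>+a. g (y, a) \<partial>\<pi> (Suc t) y) \<partial>transition M z)"
proof -
  have a: "snd z \<in> actions M"
    using z feasible_sub[of "fst z"] by (auto simp: controlled_pairs_def nontarget_def)
  let ?k = "\<lambda>y. if y \<in> target M then return (pair_algebra M) (y, snd z)
      else distr (\<pi> (Suc t) y) (pair_algebra M) (Pair y)"
  have "(\<integral>\<^sup>+w. g w \<partial>step_kernel M \<pi> t z) = (\<integral>\<^sup>+w. g w \<partial>(transition M z \<bind> ?k))"
    using z by (simp add: step_kernel_def)
  also have "\<dots> = (\<integral>\<^sup>+y. (\<integral>\<^sup>+w. g w \<partial>?k y) \<partial>transition M z)"
  proof (rule nn_integral_bind[OF g])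
    show "?k \<in> transition M z \<rightarrow>\<^sub>M subprob_algebra (pair_algebra M)"
      unfolding measurable_cong_sets[OF sets_transition[OF z] refl]
      by (rule measurable_prob_algebraD[OF arrival_kernel_measurable[OF a]])
  qed
  also have "\<dots> = (\<integral>\<^sup>+y. (if y \<in> target M then g (y, snd z) else \<integral>\<^sup>+a. g (y, a) \<partial>\<pi> (Suc t) y) \<partial>transition M z)"
  proof (rule nn_integral_cong)
    fix y assume "y \<in> space (transition M z)"
    then have y: "y \<in> states M"
      using sets_eq_imp_space_eq[OF sets_transition[OF z]] by (simp add: space_restrict_space)
    show "(\<integral>\<^sup>+w. g w \<partial>?k y) = (if y \<in> target M then g (y, snd z) else \<integral>\<^sup>+a. g (y, a) \<partial>\<pi> (Suc t) y)"
    proof (cases "y \<in> target M")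
      case True
      then show ?thesis using y a g
        by (simp add: nn_integral_return space_pair_measure space_restrict_space)
    next
      case False
      then have "y \<in> nontarget M" using y by (simp add: nontarget_def)
      from nn_integral_distr[OF action_measurable_Pair[OF this], of g "Suc t"] g False show ?thesis by simp
    qed
  qed
  finally show ?thesis .
qed

lemma nn_integral_step_kernel_frozen:
  assumes "z \<in> space (pair_algebra M)" "z \<notin> controlled_pairs M" "g \<in> borel_measurable (pair_algebra M)"
  shows "(\<integral>\<^sup>+w. g w \<partial>step_kernel M \<pi> t z) = g z"
  using assms by (simp add: step_kernel_def nn_integral_return)

text \<open>
  To show that successive pairs of a trajectory are almost surely related by \<open>Z\<close>, it suffices to
  check the three kinds of transition: freezing, hitting the target, and moving on to a controlled
  pair.
\<close>
lemma AE_trajectory_step: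
  assumes x: "x \<in> nontarget M"
    and Z: "Measurable.pred (pair_algebra M \<Otimes>\<^sub>M pair_algebra M) Z"
    and frozen: "\<And>z. z \<in> space (pair_algebra M) \<Longrightarrow> z \<notin> controlled_pairs M \<Longrightarrow> Z (z, z)"
    and hit: "\<And>z y. z \<in> controlled_pairs M \<Longrightarrow> y \<in> target M \<Longrightarrow> Z (z, (y, snd z))"
    and move: "\<And>z y a. z \<in> controlled_pairs M \<Longrightarrow> (y, a) \<in> controlled_pairs M \<Longrightarrow> Z (z, (y, a))"
  shows "AE \<omega> in trajectory M \<pi> x. Z (\<omega> t, \<omega> (Suc t))"
proof -
  let ?S = "pair_algebra M"
  let ?g = "\<lambda>p. if Z p then 0 else (1::ennreal)"
  have g: "?g \<in> borel_measurable (?S \<Otimes>\<^sub>M ?S)" using Z by measurable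
  have pair: "(\<lambda>\<omega>. (\<omega> t, \<omega> (Suc t))) \<in> trajectory M \<pi> x \<rightarrow>\<^sub>M ?S \<Otimes>\<^sub>M ?S"
    by (intro measurable_Pair component_measurable[OF x])
  have "(\<integral>\<^sup>+\<omega>. ?g (\<omega> t, \<omega> (Suc t)) \<partial>trajectory M \<pi> x) =
    (\<integral>\<^sup>+\<omega>. (\<integral>\<^sup>+w. ?g (\<omega> t, w) \<partial>step_kernel M \<pi> t (\<omega> t)) \<partial>trajectory M \<pi> x)"
    by (rule trajectory_step[OF x g])
  also have "\<dots> = (\<integral>\<^sup>+\<omega>. 0 \<partial>trajectory M \<pi> x)"
  proof (rule nn_integral_cong)
    fix \<omega> assume "\<omega> \<in> space (trajectory M \<pi> x)"
    then have sp: "\<omega> t \<in> space ?S" using measurable_space[OF component_measurable[OF x]] by blast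
    have g': "(\<lambda>w. ?g (\<omega> t, w)) \<in> borel_measurable ?S"
      using g sp by (rule measurable_Pair2)
    show "(\<integral>\<^sup>+w. ?g (\<omega> t, w) \<partial>step_kernel M \<pi> t (\<omega> t)) = 0"
    proof (cases "\<omega> t \<in> controlled_pairs M")
      case True
      have "(\<integral>\<^sup>+a. ?g (\<omega> t, (y, a)) \<partial>\<pi> (Suc t) y) = 0" if "y \<in> nontarget M" for y
      proof -
        have "AE a in \<pi> (Suc t) y. ?g (\<omega> t, (y, a)) = 0"
          using AE_policy[OF that]
        proof eventually_elim
          case (elim a)
          then show ?case using move[OF True, of y a] that by (simp add: controlled_pairs_def)
        qed
        then have "(\<integral>\<^sup>+a. ?g (\<omega> t, (y, a)) \<partial>\<pi> (Suc t) y) = (\<integral>\<^sup>+a. 0 \<partial>\<pi> (Suc t) y)"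
          by (rule nn_integral_cong_AE)
        then show ?thesis by simp
      qed
      moreover have "y \<in> states M" if "y \<in> space (transition M (\<omega> t))" for y
        using that sets_eq_imp_space_eq[OF sets_transition[OF True]] by (simp add: space_restrict_space)
      ultimately have "(\<integral>\<^sup>+y. (if y \<in> target M then ?g (\<omega> t, (y, snd (\<omega> t)))
          else \<integral>\<^sup>+a. ?g (\<omega> t, (y, a)) \<partial>\<pi> (Suc t) y) \<partial>transition M (\<omega> t)) = (\<integral>\<^sup>+y. 0 \<partial>transition M (\<omega> t))"
        by (intro nn_integral_cong) (simp add: hit[OF True] nontarget_def)
      then show ?thesis
        by (simp add: nn_integral_step_kernel_controlled[OF True g'])
    next
      case False
      then show ?thesis using nn_integral_step_kernel_frozen[OF sp False g'] frozen[OF sp False] by simp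
    qed
  qed
  finally have "(\<integral>\<^sup>+\<omega>. ?g (\<omega> t, \<omega> (Suc t)) \<partial>trajectory M \<pi> x) = 0" by simp
  then have "AE \<omega> in trajectory M \<pi> x. ?g (\<omega> t, \<omega> (Suc t)) = 0"
    using nn_integral_0_iff_AE[OF measurable_compose[OF pair g]] by simp
  then show ?thesis by eventually_elim (simp split: if_splits)
qed

lemma AE_controlled_before_target:
  assumes x: "x \<in> nontarget M"
  shows "AE \<omega> in trajectory M \<pi> x. fst (\<omega> t) \<notin> target M \<longrightarrow> \<omega> t \<in> controlled_pairs M"
proof (induction t)
  let ?S = "pair_algebra M"
  have [measurable]: "Measurable.pred ?S (\<lambda>z. z \<in> controlled_pairs M)" by (rule controlled_pairs_pred)
  have fst_borel: "fst \<in> ?S \<rightarrow>\<^sub>M borel"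
    by (rule measurable_compose[OF measurable_fst measurable_restrict_space1]) simp
  have [measurable]: "Measurable.pred ?S (\<lambda>z. fst z \<in> target M)"
    by (rule measurable_compose[OF fst_borel]) (simp add: target_borel pred_def)
  {
    case 0
    let ?g = "\<lambda>z. if fst z \<notin> target M \<longrightarrow> z \<in> controlled_pairs M then 0 else (1::ennreal)"
    have g: "?g \<in> borel_measurable ?S" by measurable
    have "AE a in \<pi> 0 x. ?g (x, a) = 0"
      using AE_policy[OF x] by eventually_elim (simp add: controlled_pairs_def x)
    then have "(\<integral>\<^sup>+\<omega>. ?g (\<omega> 0) \<partial>trajectory M \<pi> x) = (\<integral>\<^sup>+a. 0 \<partial>\<pi> 0 x)"
      unfolding trajectory_initial[OF x g] by (rule nn_integral_cong_AE)
    then have "AE \<omega> in trajectory M \<pi> x. ?g (\<omega> 0) = 0"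
      using measurable_compose[OF component_measurable[OF x] g, of 0] by (simp add: nn_integral_0_iff_AE)
    then show ?case by eventually_elim (simp split: if_splits)
  next
    case (Suc t)
    let ?Z = "\<lambda>p. (fst (fst p) \<notin> target M \<longrightarrow> fst p \<in> controlled_pairs M) \<longrightarrow>
      fst (snd p) \<notin> target M \<longrightarrow> snd p \<in> controlled_pairs M"
    have "AE \<omega> in trajectory M \<pi> x. ?Z (\<omega> t, \<omega> (Suc t))"
    proof (rule AE_trajectory_step[OF x])
      show "Measurable.pred (?S \<Otimes>\<^sub>M ?S) ?Z" by measurable
    qed auto
    with Suc show ?case by eventually_elim simp
  }
qed

text \<open>
  A pair that is not controlled is frozen. Together with the preceding lemma this shows that,
  almost surely, the target has not been hit up to time \<open>t\<close> iff the pair at time \<open>t\<close> is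
  controlled.
\<close>
lemma AE_controlled_Suc:
  assumes x: "x \<in> nontarget M"
  shows "AE \<omega> in trajectory M \<pi> x. \<omega> (Suc t) \<in> controlled_pairs M \<longrightarrow> \<omega> t \<in> controlled_pairs M"
proof -
  let ?S = "pair_algebra M"
  have [measurable]: "Measurable.pred ?S (\<lambda>z. z \<in> controlled_pairs M)" by (rule controlled_pairs_pred)
  have "AE \<omega> in trajectory M \<pi> x. (\<lambda>p. snd p \<in> controlled_pairs M \<longrightarrow> fst p \<in> controlled_pairs M) (\<omega> t, \<omega> (Suc t))"
    by (rule AE_trajectory_step[OF x]) auto
  then show ?thesis by simp
qed

lemma expected_stage_cost_measurable: "expected_stage_cost \<pi> i t \<in> borel_measurable (pair_algebra M)"
proof (induction i arbitrary: t)
  case (Suc i)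
  show ?case
    using measurable_compose[OF measurable_prob_algebraD[OF step_kernel_measurable[OF \<pi>]]
        nn_integral_measurable_subprob_algebra[OF Suc]] by simp
qed (simp add: stage_cost_measurable)

lemma nn_integral_expected_stage_cost:
  assumes x: "x \<in> nontarget M"
  shows "(\<integral>\<^sup>+\<omega>. expected_stage_cost \<pi> i t (\<omega> t) \<partial>trajectory M \<pi> x) =
    (\<integral>\<^sup>+\<omega>. stage_cost (\<omega> (t + i)) \<partial>trajectory M \<pi> x)"
proof (induction i arbitrary: t)
  case (Suc i)
  have "(\<lambda>p. expected_stage_cost \<pi> i (Suc t) (snd p)) \<in> borel_measurable (pair_algebra M \<Otimes>\<^sub>M pair_algebra M)"
    by (rule measurable_compose[OF measurable_snd expected_stage_cost_measurable])
  from trajectory_step[OF x this, of t] Suc[of "Suc t"] show ?case by simp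
qed simp

lemma expected_stage_cost_Suc:
  assumes z: "z \<in> controlled_pairs M"
  shows "expected_stage_cost \<pi> (Suc i) t z =
    (\<integral>\<^sup>+y\<in>nontarget M. (\<integral>\<^sup>+a. expected_stage_cost \<pi> i (Suc t) (y, a) \<partial>\<pi> (Suc t) y) \<partial>transition M z)"
proof -
  have frozen: "expected_stage_cost \<pi> i t w = 0"
    if "w \<in> space (pair_algebra M)" "w \<notin> controlled_pairs M" for w i t
    using that
  proof (induction i arbitrary: t)
    case (Suc i)
    then show ?case
      using nn_integral_step_kernel_frozen[OF Suc.prems expected_stage_cost_measurable] by simp
  qed (simp add: stage_cost_def)
  have a: "snd z \<in> actions M"
    using z feasible_sub[of "fst z"] by (auto simp: controlled_pairs_def nontarget_def)
  have "expected_stage_cost \<pi> (Suc i) t z = (\<integral>\<^sup>+y. (if y \<in> target M then expected_stage_cost \<pi> i (Suc t) (y, snd z)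
      else \<integral>\<^sup>+a. expected_stage_cost \<pi> i (Suc t) (y, a) \<partial>\<pi> (Suc t) y) \<partial>transition M z)"
    using nn_integral_step_kernel_controlled[OF z expected_stage_cost_measurable] by simp
  also have "\<dots> = (\<integral>\<^sup>+y\<in>nontarget M. (\<integral>\<^sup>+a. expected_stage_cost \<pi> i (Suc t) (y, a) \<partial>\<pi> (Suc t) y) \<partial>transition M z)"
  proof (rule nn_integral_cong)
    fix y assume "y \<in> space (transition M z)"
    then have "y \<in> states M"
      using sets_eq_imp_space_eq[OF sets_transition[OF z]] by (simp add: space_restrict_space)
    moreover have "(y, snd z) \<notin> controlled_pairs M" if "y \<in> target M"
      using that by (simp add: controlled_pairs_def nontarget_def)
    ultimately show "(if y \<in> target M then expected_stage_cost \<pi> i (Suc t) (y, snd z)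
      else \<integral>\<^sup>+a. expected_stage_cost \<pi> i (Suc t) (y, a) \<partial>\<pi> (Suc t) y) =
      (\<integral>\<^sup>+a. expected_stage_cost \<pi> i (Suc t) (y, a) \<partial>\<pi> (Suc t) y) * indicator (nontarget M) y"
      using a by (auto simp: frozen nontarget_def space_pair_measure space_restrict_space)
  qed
  finally show ?thesis .
qed

lemma policy_average_measurable:
  assumes g: "g \<in> borel_measurable (pair_algebra M)"
  shows "(\<lambda>y. (\<integral>\<^sup>+a. g (y, a) \<partial>\<pi> t y) * indicator (nontarget M) y) \<in> borel_measurable (state_algebra M)"
proof -
  let ?N = "restrict_space borel (nontarget M)"
  have "(\<lambda>y. \<integral>\<^sup>+a. g (y, a) \<partial>\<pi> t y) \<in> borel_measurable ?N"
  proof (rule nn_integral_measurable_subprob_algebra2[where N="action_algebra M"])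
    show "\<pi> t \<in> ?N \<rightarrow>\<^sub>M subprob_algebra (action_algebra M)"
      by (rule measurable_prob_algebraD[OF policyD[OF \<pi>]])
    have "(\<lambda>y. y) \<in> ?N \<rightarrow>\<^sub>M state_algebra M"
      by (intro measurable_restrict_space2 measurable_restrict_space1)
         (auto simp: space_restrict_space nontarget_def)
    then have "(\<lambda>p. (fst p, snd p)) \<in> ?N \<Otimes>\<^sub>M action_algebra M \<rightarrow>\<^sub>M pair_algebra M"
      by (intro measurable_Pair measurable_snd measurable_compose[OF measurable_fst])
    from measurable_compose[OF this g]
    show "(\<lambda>(y, a). g (y, a)) \<in> borel_measurable (?N \<Otimes>\<^sub>M action_algebra M)"
      by (simp add: split_beta')
  qed
  then have "(\<lambda>y. (\<integral>\<^sup>+a. g (y, a) \<partial>\<pi> t y) * indicator (nontarget M) y) \<in> borel_measurable borel"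
    by (subst (asm) borel_measurable_restrict_space_iff_ennreal) (simp_all add: nontarget_borel)
  then show ?thesis by (rule measurable_restrict_space1)
qed

lemma horizon_value_eq_sum:
  assumes "x \<in> nontarget M"
  shows "horizon_value \<pi> n t x =
    (\<Sum>i<n. ennreal (discount M ^ i) * (\<integral>\<^sup>+a. expected_stage_cost \<pi> i t (x, a) \<partial>\<pi> t x))"
  using assms
proof (induction n arbitrary: t x)
  case (Suc n)
  note x = Suc.prems
  have stage: "one_stage M (horizon_value \<pi> n (Suc t)) x a =
      (\<Sum>i<Suc n. ennreal (discount M ^ i) * expected_stage_cost \<pi> i t (x, a))"
    if a: "a \<in> feasible M x" for a
  proof -
    have z: "(x, a) \<in> controlled_pairs M" using x a by (simp add: controlled_pairs_def)
    have "(\<integral>\<^sup>+y\<in>nontarget M. horizon_value \<pi> n (Suc t) y \<partial>transition M (x, a)) =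
      (\<integral>\<^sup>+y. (\<Sum>i<n. ennreal (discount M ^ i) * ((\<integral>\<^sup>+a. expected_stage_cost \<pi> i (Suc t) (y, a) \<partial>\<pi> (Suc t) y) * indicator (nontarget M) y))
        \<partial>transition M (x, a))"
      by (intro nn_integral_cong) (simp add: Suc.IH split: split_indicator)
    also have "\<dots> = (\<Sum>i<n. ennreal (discount M ^ i) * expected_stage_cost \<pi> (Suc i) t (x, a))"
    proof -
      have "(\<lambda>y. (\<integral>\<^sup>+a. expected_stage_cost \<pi> i (Suc t) (y, a) \<partial>\<pi> (Suc t) y) * indicator (nontarget M) y)
          \<in> borel_measurable (transition M (x, a))" for i
        unfolding measurable_cong_sets[OF sets_transition[OF z] refl]
        by (rule policy_average_measurable[OF expected_stage_cost_measurable])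
      then show ?thesis
        unfolding expected_stage_cost_Suc[OF z] by (simp add: nn_integral_sum nn_integral_cmult)
    qed
    finally have "ennreal (discount M) * (\<integral>\<^sup>+y\<in>nontarget M. horizon_value \<pi> n (Suc t) y \<partial>transition M (x, a)) =
      (\<Sum>i<n. ennreal (discount M ^ Suc i) * expected_stage_cost \<pi> (Suc i) t (x, a))"
      using discount_pos by (simp add: sum_distrib_left ennreal_mult' mult.assoc)
    then show ?thesis
      unfolding one_stage_def sum.lessThan_Suc_shift using z by (simp add: stage_cost_def)
  qed
  have "horizon_value \<pi> (Suc n) t x =
      (\<integral>\<^sup>+a. (\<Sum>i<Suc n. ennreal (discount M ^ i) * expected_stage_cost \<pi> i t (x, a)) \<partial>\<pi> t x)"
    unfolding horizon_value.simps
  proof (rule nn_integral_cong_AE)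
    show "AE a in \<pi> t x. one_stage M (horizon_value \<pi> n (Suc t)) x a =
        (\<Sum>i<Suc n. ennreal (discount M ^ i) * expected_stage_cost \<pi> i t (x, a))"
      using AE_policy[OF x] by eventually_elim (rule stage)
  qed
  also have "\<dots> = (\<Sum>i<Suc n. ennreal (discount M ^ i) * (\<integral>\<^sup>+a. expected_stage_cost \<pi> i t (x, a) \<partial>\<pi> t x))"
  proof -
    have "(\<lambda>a. expected_stage_cost \<pi> i t (x, a)) \<in> borel_measurable (\<pi> t x)" for i
      by (rule measurable_compose[OF action_measurable_Pair[OF x] expected_stage_cost_measurable])
    then show ?thesis by (simp add: nn_integral_sum nn_integral_cmult del: sum.lessThan_Suc)
  qed
  finally show ?case .
qed simp

lemma horizon_value_measurable:
  "horizon_value \<pi> n t \<in> borel_measurable (restrict_space borel (nontarget M))"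
proof -
  have "(\<lambda>x. \<Sum>i<n. ennreal (discount M ^ i) *
      ((\<integral>\<^sup>+a. expected_stage_cost \<pi> i t (x, a) \<partial>\<pi> t x) * indicator (nontarget M) x))
      \<in> borel_measurable (state_algebra M)"
    by (intro borel_measurable_sum borel_measurable_times_ennreal borel_measurable_const
        policy_average_measurable expected_stage_cost_measurable)
  then have "(\<lambda>x. \<Sum>i<n. ennreal (discount M ^ i) *
      ((\<integral>\<^sup>+a. expected_stage_cost \<pi> i t (x, a) \<partial>\<pi> t x) * indicator (nontarget M) x))
      \<in> borel_measurable (restrict_space borel (nontarget M))"
  proof (rule measurable_compose[rotated])
    show "(\<lambda>x. x) \<in> restrict_space borel (nontarget M) \<rightarrow>\<^sub>M state_algebra M"
      by (intro measurable_restrict_space2 measurable_restrict_space1)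
         (auto simp: space_restrict_space nontarget_def)
  qed
  then show ?thesis
    by (rule measurable_cong[THEN iffD1, rotated])
       (simp add: space_restrict_space horizon_value_eq_sum)
qed

theorem policy_value_eq_SUP_horizon_value:
  assumes x: "x \<in> nontarget M"
  shows "policy_value M \<pi> x = (SUP n. horizon_value \<pi> n 0 x)"
proof -
  let ?T = "trajectory M \<pi> x"
  have [measurable]: "(\<lambda>\<omega>. stage_cost (\<omega> i)) \<in> borel_measurable ?T" for i
    by (rule measurable_compose[OF component_measurable[OF x] stage_cost_measurable])
  have "AE \<omega> in ?T. \<forall>t. (fst (\<omega> t) \<notin> target M \<longrightarrow> \<omega> t \<in> controlled_pairs M) \<and>
      (\<omega> (Suc t) \<in> controlled_pairs M \<longrightarrow> \<omega> t \<in> controlled_pairs M)"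
    using AE_controlled_before_target[OF x] AE_controlled_Suc[OF x] by (simp add: AE_all_countable)
  then have "AE \<omega> in ?T. (\<Sum>i. if enat i < hitting_time M \<omega> then ennreal (discount M ^ i * cost M (\<omega> i)) else 0) =
      (\<Sum>i. ennreal (discount M ^ i) * stage_cost (\<omega> i))"
  proof eventually_elim
    case (elim \<omega>)
    have earlier: "\<omega> j \<in> controlled_pairs M" if "j \<le> i" "\<omega> i \<in> controlled_pairs M" for i j
      using that by (induction rule: dec_induct[of j i, consumes 1]) (use elim in auto)
    have "enat i < hitting_time M \<omega> \<longleftrightarrow> \<omega> i \<in> controlled_pairs M" for i
      unfolding less_hitting_time_iff
    proof
      assume "\<forall>j\<le>i. fst (\<omega> j) \<notin> target M"
      then show "\<omega> i \<in> controlled_pairs M" using elim by simp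
    next
      assume "\<omega> i \<in> controlled_pairs M"
      then have "\<omega> j \<in> controlled_pairs M" if "j \<le> i" for j using earlier that by blast
      then show "\<forall>j\<le>i. fst (\<omega> j) \<notin> target M"
        by (fastforce simp: controlled_pairs_def nontarget_def)
    qed
    then show ?case
      using discount_pos by (intro suminf_cong) (simp add: stage_cost_def ennreal_mult')
  qed
  then have "policy_value M \<pi> x = (\<integral>\<^sup>+\<omega>. (\<Sum>i. ennreal (discount M ^ i) * stage_cost (\<omega> i)) \<partial>?T)"
    unfolding policy_value_def by (rule nn_integral_cong_AE)
  also have "\<dots> = (\<Sum>i. ennreal (discount M ^ i) * (\<integral>\<^sup>+\<omega>. stage_cost (\<omega> i) \<partial>?T))"
    by (simp add: nn_integral_suminf nn_integral_cmult)
  also have "\<dots> = (\<Sum>i. ennreal (discount M ^ i) * (\<integral>\<^sup>+a. expected_stage_cost \<pi> i 0 (x, a) \<partial>\<pi> 0 x))"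
    using nn_integral_expected_stage_cost[OF x, of _ 0] trajectory_initial[OF x expected_stage_cost_measurable]
    by simp
  also have "\<dots> = (SUP n. horizon_value \<pi> n 0 x)"
    by (simp add: suminf_eq_SUP horizon_value_eq_sum[OF x])
  finally show ?thesis .
qed

end

end

section \<open>The dynamic programming operator\<close>

text \<open>
  A control model with compact sets of feasible actions, lower semicontinuous nonnegative cost and
  strongly Feller transition law.
\<close>
locale semicontinuous_control_model = control_model M
  for M :: "('s::polish_space, 'a::polish_space) control_data" +
  assumes compact_feasible: "\<And>x. x \<in> states M \<Longrightarrow> compact (feasible M x)"
    and cost_lsc: "lower_semicontinuous_on (controlled_pairs M) (cost M)"
    and cost_nonneg: "\<And>z. z \<in> controlled_pairs M \<Longrightarrow> 0 \<le> cost M z"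
    and strong_Feller: "strongly_Feller M"
begin

abbreviation "measurable_value \<xi> \<equiv> (\<xi> :: 's \<Rightarrow> ennreal) \<in> borel_measurable (restrict_space borel (nontarget M))"

lemma value_indicator_measurable:
  assumes "measurable_value \<xi>"
  shows "(\<lambda>y. \<xi> y * indicator (nontarget M) y) \<in> borel_measurable (state_algebra M)"
proof -
  have "(\<lambda>y. \<xi> y * indicator (nontarget M) y) \<in> borel_measurable borel"
    using assms by (subst (asm) borel_measurable_restrict_space_iff_ennreal) (simp_all add: nontarget_borel)
  then show ?thesis by (rule measurable_restrict_space1)
qed

lemma one_stage_cong:
  assumes "\<And>y. y \<in> nontarget M \<Longrightarrow> \<xi> y = \<eta> y" shows "one_stage M \<xi> x a = one_stage M \<eta> x a"
proof -
  have "(\<integral>\<^sup>+y\<in>nontarget M. \<xi> y \<partial>transition M (x, a)) = (\<integral>\<^sup>+y\<in>nontarget M. \<eta> y \<partial>transition M (x, a))"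
    by (intro nn_integral_cong) (simp add: assms split: split_indicator)
  then show ?thesis by (simp add: one_stage_def)
qed

lemma one_stage_mono:
  assumes "\<And>y. y \<in> nontarget M \<Longrightarrow> \<xi> y \<le> \<eta> y" shows "one_stage M \<xi> x a \<le> one_stage M \<eta> x a"
  unfolding one_stage_def
  by (intro add_left_mono mult_left_mono nn_integral_mono) (auto simp: assms split: split_indicator)

lemma one_stage_SUP:
  fixes F :: "nat \<Rightarrow> 's \<Rightarrow> ennreal"
  assumes z: "(x, a) \<in> controlled_pairs M"
    and F: "\<And>n. measurable_value (F n)" and inc: "\<And>y. y \<in> nontarget M \<Longrightarrow> incseq (\<lambda>n. F n y)"
  shows "one_stage M (\<lambda>y. SUP n. F n y) x a = (SUP n. one_stage M (F n) x a)"
proof -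
  have "(\<integral>\<^sup>+y\<in>nontarget M. (SUP n. F n y) \<partial>transition M (x, a)) =
      (\<integral>\<^sup>+y. (SUP n. F n y * indicator (nontarget M) y) \<partial>transition M (x, a))"
    by (simp add: SUP_mult_right_ennreal)
  also have "\<dots> = (SUP n. \<integral>\<^sup>+y\<in>nontarget M. F n y \<partial>transition M (x, a))"
  proof (rule nn_integral_monotone_convergence_SUP)
    show "incseq (\<lambda>n y. F n y * indicator (nontarget M) y)"
      using inc by (auto simp: incseq_def le_fun_def split: split_indicator)
    show "(\<lambda>y. F n y * indicator (nontarget M) y) \<in> borel_measurable (transition M (x, a))" for n
      unfolding measurable_cong_sets[OF sets_transition[OF z] refl]
      by (rule value_indicator_measurable[OF F])
  qed
  finally show ?thesis
    by (simp add: one_stage_def SUP_mult_left_ennreal ennreal_SUP_add_right)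
qed

text \<open>
  The expected next value, with the value function cut off at \<open>k\<close> and set to zero on the target.
  The integrand is bounded, so the strong Feller property makes the expectation continuous in the
  pair.
\<close>
definition truncated_expectation :: "('s \<Rightarrow> ennreal) \<Rightarrow> nat \<Rightarrow> 's \<times> 'a \<Rightarrow> real" where
  "truncated_expectation \<xi> k z =
     (\<integral>y. enn2real (min (\<xi> y * indicator (nontarget M) y) (of_nat k)) \<partial>transition M z)"

lemma truncation_bounds:
  "0 \<le> enn2real (min u (of_nat k))" "enn2real (min u (of_nat k)) \<le> real k"
  "ennreal (enn2real (min u (of_nat k))) = min u (of_nat k)"
proof -
  have "min u (of_nat k) < \<top>"
    by (rule le_less_trans[OF min.cobounded2 of_nat_less_top])
  then show eq: "ennreal (enn2real (min u (of_nat k))) = min u (of_nat k)"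
    by simp
  show "enn2real (min u (of_nat k)) \<le> real k"
    by (rule enn2real_leI) (simp_all add: ennreal_of_nat_eq_real_of_nat)
qed simp

lemma truncated_expectation_continuous:
  assumes "measurable_value \<xi>"
  shows "continuous_on (controlled_pairs M) (truncated_expectation \<xi> k)"
proof -
  let ?g = "\<lambda>y. enn2real (min (\<xi> y * indicator (nontarget M) y) (of_nat k))"
  have "?g \<in> borel_measurable (state_algebra M)"
    using value_indicator_measurable[OF assms] by measurable
  moreover have "bounded (?g ` states M)"
    using truncation_bounds(1,2) by (auto intro!: boundedI[of _ "real k"])
  ultimately show ?thesis
    using strong_Feller unfolding strongly_Feller_def truncated_expectation_def[abs_def] by blast
qed

lemma expectation_eq_SUP_truncated:
  assumes z: "z \<in> controlled_pairs M" and \<xi>: "measurable_value \<xi>"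
  shows "(\<integral>\<^sup>+y\<in>nontarget M. \<xi> y \<partial>transition M z) = (SUP k. ennreal (truncated_expectation \<xi> k z))"
proof -
  interpret prob_space "transition M z" by (rule prob_space_transition[OF z])
  let ?h = "\<lambda>k y. min (\<xi> y * indicator (nontarget M) y) (of_nat k) :: ennreal"
  have hm: "?h k \<in> borel_measurable (transition M z)" for k
    unfolding measurable_cong_sets[OF sets_transition[OF z] refl]
    using value_indicator_measurable[OF \<xi>] by measurable
  have "(\<integral>\<^sup>+y\<in>nontarget M. \<xi> y \<partial>transition M z) = (\<integral>\<^sup>+y. (SUP k. ?h k y) \<partial>transition M z)"
  proof (rule nn_integral_cong)
    fix y
    show "\<xi> y * indicator (nontarget M) y = (SUP k. ?h k y)"
      by (simp only: inf_min[symmetric] inf_SUP[symmetric] ennreal_SUP_of_nat_eq_top inf_top_right)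
  qed
  also have "\<dots> = (SUP k. \<integral>\<^sup>+y. ?h k y \<partial>transition M z)"
  proof (rule nn_integral_monotone_convergence_SUP[OF _ hm])
    show "incseq ?h"
      unfolding incseq_def le_fun_def by (intro allI impI min.mono order.refl of_nat_mono)
  qed
  also have "(\<lambda>k. \<integral>\<^sup>+y. ?h k y \<partial>transition M z) = (\<lambda>k. ennreal (truncated_expectation \<xi> k z))"
  proof
    fix k
    have "integrable (transition M z) (\<lambda>y. enn2real (?h k y))"
      using hm truncation_bounds by (intro integrable_const_bound[of _ "real k"]) auto
    then show "(\<integral>\<^sup>+y. ?h k y \<partial>transition M z) = ennreal (truncated_expectation \<xi> k z)"
      unfolding truncated_expectation_def
      by (subst nn_integral_eq_integral[symmetric]) (simp_all add: truncation_bounds)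
  qed
  finally show ?thesis .
qed

lemma one_stage_le_iff:
  assumes z: "(x, a) \<in> controlled_pairs M" and \<xi>: "measurable_value \<xi>" and r: "0 \<le> r"
  shows "one_stage M \<xi> x a \<le> ennreal r \<longleftrightarrow>
    (\<forall>k. cost M (x, a) + discount M * truncated_expectation \<xi> k (x, a) \<le> r)"
proof -
  have nonneg: "0 \<le> truncated_expectation \<xi> k (x, a)" for k
    unfolding truncated_expectation_def by (intro Bochner_Integration.integral_nonneg) simp
  have "one_stage M \<xi> x a = (SUP k. ennreal (cost M (x, a)) + ennreal (discount M) * ennreal (truncated_expectation \<xi> k (x, a)))"
    unfolding one_stage_def expectation_eq_SUP_truncated[OF z \<xi>]
    by (simp add: SUP_mult_left_ennreal ennreal_SUP_add_right)
  also have "\<dots> = (SUP k. ennreal (cost M (x, a) + discount M * truncated_expectation \<xi> k (x, a)))"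
    using cost_nonneg[OF z] nonneg discount_pos by (simp add: ennreal_mult')
  finally show ?thesis using r by (simp add: SUP_le_iff)
qed

text \<open>
  The one-stage cost is lower semicontinuous in the action: by \<open>one_stage_le_iff\<close> its sublevel
  sets are intersections of sublevel sets of sums of the lower semicontinuous cost and a
  continuous function.
\<close>
lemma one_stage_sublevel_compact:
  assumes x: "x \<in> nontarget M" and \<xi>: "measurable_value \<xi>"
  shows "compact {a \<in> feasible M x. one_stage M \<xi> x a \<le> r}"
proof (cases r)
  case top
  then show ?thesis using compact_feasible x by (simp add: nontarget_def)
next
  case (real r')
  let ?I = "\<lambda>k a. truncated_expectation \<xi> k (x, a)"
  have K: "compact (feasible M x)" using compact_feasible x by (simp add: nontarget_def)
  have pair: "(x, a) \<in> controlled_pairs M" if "a \<in> feasible M x" for a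
    using that x by (simp add: controlled_pairs_def)
  have "closed {a \<in> feasible M x. one_stage M \<xi> x a \<le> r}"
    unfolding closed_sequential_limits
  proof (intro allI impI, elim conjE)
    fix s a assume s: "\<forall>n. s n \<in> {a \<in> feasible M x. one_stage M \<xi> x a \<le> r}" and lim: "s \<longlonglongrightarrow> a"
    have a: "a \<in> feasible M x"
      using closed_sequentially[OF compact_imp_closed[OF K] _ lim] s by simp
    have lim2: "(\<lambda>j. (x, s j)) \<longlonglongrightarrow> (x, a)" by (intro tendsto_intros lim)
    have "cost M (x, a) + discount M * ?I k a \<le> r'" for k
    proof -
      have "(\<lambda>j. ?I k (s j)) \<longlonglongrightarrow> ?I k a"
        using continuous_on_tendsto_compose[OF truncated_expectation_continuous[OF \<xi>] lim2 pair[OF a]] s pair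
        by simp
      then have lim_I: "(\<lambda>j. ereal (r' - discount M * ?I k (s j))) \<longlonglongrightarrow> ereal (r' - discount M * ?I k a)"
        by (intro tendsto_intros)
      have "cost M (x, s j) + discount M * ?I k (s j) \<le> r'" for j
        using s one_stage_le_iff[OF pair \<xi> real(1), of "s j"] real(2) by simp
      then have le: "cost M (x, s j) \<le> r' - discount M * ?I k (s j)" for j
        by (simp add: algebra_simps)
      have "ereal (cost M (x, a)) \<le> liminf (\<lambda>j. ereal (cost M (x, s j)))"
        using cost_lsc lim2 pair a s unfolding lower_semicontinuous_on_def by simp
      also have "\<dots> \<le> liminf (\<lambda>j. ereal (r' - discount M * ?I k (s j)))"
        by (intro Liminf_mono always_eventually allI) (simp add: le)
      also have "\<dots> = ereal (r' - discount M * ?I k a)"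
        by (rule lim_imp_Liminf[OF _ lim_I]) simp
      finally show ?thesis by simp
    qed
    then show "a \<in> {a \<in> feasible M x. one_stage M \<xi> x a \<le> r}"
      using a real(2) one_stage_le_iff[OF pair[OF a] \<xi> real(1)] by simp
  qed
  from compact_Int_closed[OF K this] show ?thesis
    by (simp add: Int_def conj_commute cong: conj_cong)
qed

text \<open>
  The dynamic programming operator. It is meaningful outside the target, where the infimum is
  attained for measurable value functions.
\<close>
definition bellman :: "('s \<Rightarrow> ennreal) \<Rightarrow> 's \<Rightarrow> ennreal" where
  "bellman \<xi> x = (INF a\<in>feasible M x. one_stage M \<xi> x a)"

lemma bellman_attained:
  assumes x: "x \<in> nontarget M" and \<xi>: "measurable_value \<xi>"
  shows "\<exists>a\<in>feasible M x. one_stage M \<xi> x a = bellman \<xi> x"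
proof -
  let ?u = "one_stage M \<xi> x" and ?K = "feasible M x"
  have K: "compact ?K" "?K \<noteq> {}" using compact_feasible feasible_nonempty x by (auto simp: nontarget_def)
  have "?K \<inter> (\<Inter>b\<in>?K. {a \<in> ?K. ?u a \<le> ?u b}) \<noteq> {}"
  proof (rule compact_imp_fip_image[OF K(1)])
    show "closed {a \<in> ?K. ?u a \<le> ?u b}" for b
      by (rule compact_imp_closed[OF one_stage_sublevel_compact[OF x \<xi>]])
    show "?K \<inter> (\<Inter>b\<in>I. {a \<in> ?K. ?u a \<le> ?u b}) \<noteq> {}" if I: "finite I" "I \<subseteq> ?K" for I
    proof (cases "I = {}")
      case False
      then obtain b where "b \<in> I" "\<forall>b'\<in>I. ?u b \<le> ?u b'"
        using arg_min_if_finite(1)[OF I(1) False, of ?u] arg_min_least[OF I(1) False, of _ ?u] by metis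
      then show ?thesis using I(2) by blast
    qed (use K in simp)
  qed
  then obtain a where "a \<in> ?K" "\<And>b. b \<in> ?K \<Longrightarrow> ?u a \<le> ?u b" by blast
  then show ?thesis unfolding bellman_def by (intro bexI[of _ a] antisym INF_greatest INF_lower) auto
qed

lemma bellman_le: "a \<in> feasible M x \<Longrightarrow> bellman \<xi> x \<le> one_stage M \<xi> x a"
  unfolding bellman_def by (rule INF_lower)

lemma bellman_mono:
  assumes "\<And>y. y \<in> nontarget M \<Longrightarrow> \<xi> y \<le> \<eta> y" shows "bellman \<xi> x \<le> bellman \<eta> x"
  unfolding bellman_def by (intro INF_mono' one_stage_mono assms)

lemma bellman_cong:
  assumes "\<And>y. y \<in> nontarget M \<Longrightarrow> \<xi> y = \<eta> y" shows "bellman \<xi> x = bellman \<eta> x"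
  unfolding bellman_def using one_stage_cong[OF assms] by simp

lemma optimality_equation_iff:
  assumes "measurable_value \<xi>"
  shows "solves_optimality_equation M \<xi> \<longleftrightarrow> (\<forall>x\<in>nontarget M. \<xi> x = bellman \<xi> x)"
proof
  assume sol: "solves_optimality_equation M \<xi>"
  show "\<forall>x\<in>nontarget M. \<xi> x = bellman \<xi> x"
  proof
    fix x assume x: "x \<in> nontarget M"
    with sol obtain a where a: "is_arg_min (one_stage M \<xi> x) (\<lambda>a. a \<in> feasible M x) a" "\<xi> x = one_stage M \<xi> x a"
      unfolding solves_optimality_equation_def by blast
    show "\<xi> x = bellman \<xi> x"
      using a unfolding bellman_def is_arg_min_linorder by (intro antisym INF_greatest) (auto intro: INF_lower)
  qed
next
  assume eq: "\<forall>x\<in>nontarget M. \<xi> x = bellman \<xi> x"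
  show "solves_optimality_equation M \<xi>"
    unfolding solves_optimality_equation_def
  proof
    fix x assume x: "x \<in> nontarget M"
    obtain a where "a \<in> feasible M x" "one_stage M \<xi> x a = bellman \<xi> x"
      using bellman_attained[OF x assms] by blast
    then show "\<exists>a. is_arg_min (one_stage M \<xi> x) (\<lambda>a. a \<in> feasible M x) a \<and> \<xi> x = one_stage M \<xi> x a"
      using eq x bellman_le by (intro exI[of _ a]) (simp add: is_arg_min_linorder)
  qed
qed

lemma one_stage_measurable:
  assumes \<xi>: "measurable_value \<xi>"
  shows "(\<lambda>z. one_stage M \<xi> (fst z) (snd z)) \<in> borel_measurable (restrict_space borel (controlled_pairs M))"
proof -
  let ?C = "restrict_space borel (controlled_pairs M)"
  have "(\<lambda>z. z) \<in> ?C \<rightarrow>\<^sub>M restrict_space borel (feasible_pairs M)"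
    by (intro measurable_restrict_space2 measurable_restrict_space1)
       (auto simp: space_restrict_space controlled_pairs_def feasible_pairs_def nontarget_def)
  then have "transition M \<in> ?C \<rightarrow>\<^sub>M subprob_algebra (state_algebra M)"
    by (rule measurable_prob_algebraD[OF measurable_compose[OF _ transition_kernel]])
  from measurable_compose[OF this nn_integral_measurable_subprob_algebra[OF value_indicator_measurable[OF \<xi>]]]
  have [measurable]: "(\<lambda>z. \<integral>\<^sup>+y\<in>nontarget M. \<xi> y \<partial>transition M z) \<in> borel_measurable ?C" .
  have [measurable]: "cost M \<in> borel_measurable ?C" by (rule cost_measurable)
  show ?thesis unfolding one_stage_def prod.collapse by measurable
qed

lemma sublevel_borel:
  assumes \<xi>: "measurable_value \<xi>" and \<rho>: "measurable_value \<rho>"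
  shows "{z \<in> controlled_pairs M. one_stage M \<xi> (fst z) (snd z) \<le> \<rho> (fst z)} \<in> sets borel"
proof -
  let ?C = "restrict_space borel (controlled_pairs M)"
  have "fst \<in> ?C \<rightarrow>\<^sub>M restrict_space borel (nontarget M)"
    by (intro measurable_restrict_space2 measurable_restrict_space1 borel_measurable_continuous_onI continuous_intros)
       (auto simp: space_restrict_space controlled_pairs_def)
  from measurable_compose[OF this \<rho>]
  have [measurable]: "(\<lambda>z. \<rho> (fst z)) \<in> borel_measurable ?C" .
  note one_stage_measurable[OF \<xi>, measurable]
  have "{z \<in> space ?C. one_stage M \<xi> (fst z) (snd z) \<le> \<rho> (fst z)} \<in> sets ?C"
    by measurable
  then show ?thesis
    by (simp add: space_restrict_space sets_restrict_space_iff controlled_pairs_borel)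
qed

lemma sublevel_section_compact:
  assumes \<xi>: "measurable_value \<xi>"
  shows "compact {a. (x, a) \<in> {z \<in> controlled_pairs M. one_stage M \<xi> (fst z) (snd z) \<le> \<rho> (fst z)}}"
proof (cases "x \<in> nontarget M")
  case True
  then show ?thesis
    using one_stage_sublevel_compact[OF True \<xi>, of "\<rho> x"] by (simp add: controlled_pairs_def)
qed (simp add: controlled_pairs_def)

text \<open>
  A sublevel set of \<open>bellman \<xi>\<close> is the projection of a Borel set with compact sections.
\<close>
lemma bellman_measurable:
  assumes \<xi>: "measurable_value \<xi>"
  shows "measurable_value (bellman \<xi>)"
proof (rule borel_measurableI_le)
  fix r
  let ?D = "{z \<in> controlled_pairs M. one_stage M \<xi> (fst z) (snd z) \<le> (\<lambda>_. r) (fst z)}"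
  have eq: "{x \<in> nontarget M. bellman \<xi> x \<le> r} = fst ` ?D"
  proof (intro equalityI subsetI)
    fix x assume x: "x \<in> {x \<in> nontarget M. bellman \<xi> x \<le> r}"
    then obtain a where "a \<in> feasible M x" "one_stage M \<xi> x a = bellman \<xi> x"
      using bellman_attained[OF _ \<xi>] by blast
    with x have "(x, a) \<in> ?D" by (simp add: controlled_pairs_def)
    then show "x \<in> fst ` ?D" by force
  next
    fix x assume "x \<in> fst ` ?D"
    then obtain a where "(x, a) \<in> ?D" by auto
    then show "x \<in> {x \<in> nontarget M. bellman \<xi> x \<le> r}"
      using bellman_le[of a x \<xi>] by (auto simp: controlled_pairs_def)
  qed
  have "{x \<in> nontarget M. bellman \<xi> x \<le> r} \<in> sets borel"
    unfolding eq
    by (rule borel_projection_compact_sections[OF sublevel_borel[OF \<xi>] sublevel_section_compact[OF \<xi>]]) simp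
  then show "{x \<in> space (restrict_space borel (nontarget M)). bellman \<xi> x \<le> r}
      \<in> sets (restrict_space borel (nontarget M))"
    by (auto simp: space_restrict_space sets_restrict_space_iff nontarget_borel)
qed

theorem bellman_selector:
  assumes \<xi>: "measurable_value \<xi>"
  obtains f where "f \<in> selectors M" "\<And>x. x \<in> nontarget M \<Longrightarrow> one_stage M \<xi> x (f x) = bellman \<xi> x"
proof -
  let ?D = "{z \<in> controlled_pairs M. one_stage M \<xi> (fst z) (snd z) \<le> bellman \<xi> (fst z)}"
  have fst_D: "fst ` ?D = nontarget M"
  proof (intro equalityI subsetI)
    fix x assume x: "x \<in> nontarget M"
    then obtain a where "a \<in> feasible M x" "one_stage M \<xi> x a = bellman \<xi> x"
      using bellman_attained[OF _ \<xi>] by blast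
    with x have "(x, a) \<in> ?D" by (simp add: controlled_pairs_def)
    then show "x \<in> fst ` ?D" by force
  qed (auto simp: controlled_pairs_def)
  obtain f where f: "f \<in> borel_measurable (restrict_space borel (fst ` ?D))" "\<And>x. x \<in> fst ` ?D \<Longrightarrow> (x, f x) \<in> ?D"
    using borel_selection_compact_sections[OF sublevel_borel[OF \<xi> bellman_measurable[OF \<xi>]] sublevel_section_compact[OF \<xi>]]
    by blast
  have feas: "f x \<in> feasible M x" and le: "one_stage M \<xi> x (f x) \<le> bellman \<xi> x" if "x \<in> nontarget M" for x
    using f(2) that unfolding fst_D by (auto simp: controlled_pairs_def)
  show thesis
  proof
    have "f \<in> restrict_space borel (nontarget M) \<rightarrow>\<^sub>M action_algebra M"
      using f(1) feas feasible_sub unfolding fst_D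
      by (intro measurable_restrict_space2) (fastforce simp: space_restrict_space nontarget_def)+
    then show "f \<in> selectors M" using feas by (simp add: selectors_def)
    show "one_stage M \<xi> x (f x) = bellman \<xi> x" if "x \<in> nontarget M" for x
      using le[OF that] bellman_le[OF feas[OF that]] by (rule antisym)
  qed
qed

section \<open>Stationary policies\<close>
lemma stationary_policy:
  assumes f: "f \<in> selectors M" shows "stationary M f \<in> policies M"
proof -
  have fm: "f \<in> restrict_space borel (nontarget M) \<rightarrow>\<^sub>M action_algebra M"
    using f by (simp add: selectors_def)
  have "emeasure (return (action_algebra M) (f x)) (feasible M x) = 1" if x: "x \<in> nontarget M" for x
  proof -
    have "feasible M x \<in> sets (action_algebra M)"
      using feasible_borel[of x] feasible_sub[of x] x actions_borel
      by (simp add: nontarget_def sets_restrict_space_iff)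
    then show ?thesis using f x by (simp add: selectors_def)
  qed
  then show ?thesis
    using measurable_compose[OF fm measurable_return_prob_space]
    by (simp add: policies_def stationary_def)
qed

text \<open>
  The one-stage cost need not be measurable in the action on the whole action set, so the integral
  with respect to the point mass is computed by replacing the integrand by a constant almost
  everywhere.
\<close>
lemma horizon_value_stationary_Suc:
  assumes f: "f \<in> selectors M" and x: "x \<in> nontarget M"
  shows "horizon_value (stationary M f) (Suc n) t x = one_stage M (horizon_value (stationary M f) n (Suc t)) x (f x)"
proof -
  let ?u = "one_stage M (horizon_value (stationary M f) n (Suc t)) x" and ?R = "return (action_algebra M) (f x)"
  have fx: "f x \<in> space (action_algebra M)"
    using f x feasible_sub[of x] by (auto simp: selectors_def nontarget_def space_restrict_space)
  have "{f x} \<in> sets (action_algebra M)"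
    using fx actions_borel by (simp add: sets_restrict_space_iff space_restrict_space)
  then have "Measurable.pred (action_algebra M) (\<lambda>a. a = f x)"
    using fx by (simp add: pred_def Collect_conv_if)
  then have "AE a in ?R. a = f x" using AE_return[OF fx] by simp
  then have "(\<integral>\<^sup>+a. ?u a \<partial>?R) = (\<integral>\<^sup>+a. ?u (f x) \<partial>?R)"
    by (intro nn_integral_cong_AE) (auto elim: eventually_mono)
  also have "\<dots> = ?u (f x)"
    using prob_space.emeasure_space_1[OF prob_space_return[OF fx]] by simp
  finally show ?thesis by (simp add: stationary_def)
qed

lemma horizon_value_stationary_shift:
  assumes f: "f \<in> selectors M" and x: "x \<in> nontarget M"
  shows "horizon_value (stationary M f) n t x = horizon_value (stationary M f) n t' x"
  using x
proof (induction n arbitrary: t t' x)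
  case (Suc n)
  then show ?case
    using one_stage_cong[of "horizon_value (stationary M f) n (Suc t)" "horizon_value (stationary M f) n (Suc t')"]
    by (simp add: horizon_value_stationary_Suc[OF f] del: horizon_value.simps)
qed simp

text \<open>
  A function that dominates its own one-stage cost under a selector dominates the value of the
  corresponding stationary policy, since it dominates all finite-horizon values.
\<close>
lemma stationary_value_le:
  assumes f: "f \<in> selectors M"
    and super: "\<And>x. x \<in> nontarget M \<Longrightarrow> one_stage M \<xi> x (f x) \<le> \<xi> x"
    and x: "x \<in> nontarget M"
  shows "policy_value M (stationary M f) x \<le> \<xi> x"
proof -
  have "horizon_value (stationary M f) n t x \<le> \<xi> x" for n t
    using x
  proof (induction n arbitrary: t x)
    case (Suc n)
    have "horizon_value (stationary M f) (Suc n) t x \<le> one_stage M \<xi> x (f x)"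
      unfolding horizon_value_stationary_Suc[OF f Suc.prems] by (rule one_stage_mono) (rule Suc.IH)
    also have "\<dots> \<le> \<xi> x" by (rule super[OF Suc.prems])
    finally show ?case .
  qed simp
  then show ?thesis
    by (simp add: policy_value_eq_SUP_horizon_value[OF stationary_policy[OF f] x] SUP_le_iff)
qed

lemma horizon_value_incseq:
  assumes "\<pi> \<in> policies M" "x \<in> nontarget M" shows "incseq (\<lambda>n. horizon_value \<pi> n t x)"
  by (rule incseq_SucI) (simp add: horizon_value_eq_sum[OF assms] del: horizon_value.simps)

lemma stationary_value_eq:
  assumes f: "f \<in> selectors M" and x: "x \<in> nontarget M"
  shows "policy_value M (stationary M f) x = one_stage M (policy_value M (stationary M f)) x (f x)"
proof -
  let ?h = "horizon_value (stationary M f)"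
  note pol = stationary_policy[OF f]
  have z: "(x, f x) \<in> controlled_pairs M" using f x by (simp add: selectors_def controlled_pairs_def)
  have "one_stage M (policy_value M (stationary M f)) x (f x) = one_stage M (\<lambda>y. SUP n. ?h n 1 y) x (f x)"
  proof (rule one_stage_cong)
    fix y assume y: "y \<in> nontarget M"
    show "policy_value M (stationary M f) y = (SUP n. ?h n 1 y)"
      unfolding policy_value_eq_SUP_horizon_value[OF pol y]
      using horizon_value_stationary_shift[OF f y] by metis
  qed
  also have "\<dots> = (SUP n. one_stage M (?h n 1) x (f x))"
    by (intro one_stage_SUP z horizon_value_measurable horizon_value_incseq pol)
  also have "\<dots> = (SUP n. ?h (Suc n) 0 x)"
    using horizon_value_stationary_Suc[OF f x, of _ 0] by simp
  also have "\<dots> = (SUP n. ?h n 0 x)"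
    using horizon_value_incseq[OF pol x, of 0]
    by (intro antisym SUP_mono) (auto simp: incseq_Suc_iff simp del: horizon_value.simps)
  finally show ?thesis by (simp add: policy_value_eq_SUP_horizon_value[OF pol x])
qed

section \<open>Value iteration and the optimal value\<close>

text \<open>
  Value iteration, started from zero: \<open>value_iterate n\<close> is the optimal value for \<open>n\<close> stages.
\<close>
primrec value_iterate :: "nat \<Rightarrow> 's \<Rightarrow> ennreal" where
  "value_iterate 0 = (\<lambda>x. 0)"
| "value_iterate (Suc n) = bellman (value_iterate n)"

definition limit_value :: "'s \<Rightarrow> ennreal" where
  "limit_value x = (SUP n. value_iterate n x)"

lemma value_iterate_measurable: "measurable_value (value_iterate n)"
  by (induction n) (simp_all add: bellman_measurable)

lemma value_iterate_incseq: "incseq (\<lambda>n. value_iterate n x)"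
proof (rule incseq_SucI)
  show "value_iterate n x \<le> value_iterate (Suc n) x" for n
    by (induction n arbitrary: x) (auto intro: bellman_mono)
qed

lemma limit_value_measurable: "measurable_value limit_value"
  unfolding limit_value_def[abs_def] by (intro borel_measurable_SUP value_iterate_measurable) simp

text \<open>
  Here limit and minimum are interchanged. The actions whose one-stage cost with respect to the
  \<open>n\<close>-th iterate is at most \<open>limit_value x\<close> form a decreasing sequence of nonempty compact sets;
  an action common to all of them has one-stage cost at most \<open>limit_value x\<close> with respect to the
  limit, by monotone convergence.
\<close>
theorem bellman_limit_value:
  assumes x: "x \<in> nontarget M" shows "bellman limit_value x = limit_value x"
proof (rule antisym)
  let ?F = "\<lambda>n. {a \<in> feasible M x. one_stage M (value_iterate n) x a \<le> limit_value x}"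
  have "(\<Inter>n. ?F n) \<noteq> {}"
  proof (rule compact_decseq_nonempty)
    show "compact (?F n)" for n by (rule one_stage_sublevel_compact[OF x value_iterate_measurable])
    show "?F n \<noteq> {}" for n
    proof -
      obtain a where "a \<in> feasible M x" "one_stage M (value_iterate n) x a = value_iterate (Suc n) x"
        using bellman_attained[OF x value_iterate_measurable, of n] by auto
      moreover have "value_iterate (Suc n) x \<le> limit_value x"
        unfolding limit_value_def by (rule SUP_upper) simp
      ultimately show ?thesis by (intro ex_in_conv[THEN iffD1] exI[of _ a]) simp
    qed
    have "one_stage M (value_iterate n) x a \<le> one_stage M (value_iterate (Suc n)) x a" for n a
      using value_iterate_incseq by (intro one_stage_mono) (simp add: incseq_Suc_iff del: value_iterate.simps)
    then show "?F (Suc n) \<subseteq> ?F n" for n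
      using order.trans by blast
  qed
  then obtain a where a: "a \<in> feasible M x" "\<And>n. one_stage M (value_iterate n) x a \<le> limit_value x" by blast
  have "one_stage M limit_value x a = (SUP n. one_stage M (value_iterate n) x a)"
    unfolding limit_value_def[abs_def] using a(1) x
    by (intro one_stage_SUP value_iterate_measurable value_iterate_incseq) (simp add: controlled_pairs_def)
  then have "one_stage M limit_value x a \<le> limit_value x" using a(2) by (simp add: SUP_le_iff)
  then show "bellman limit_value x \<le> limit_value x" using bellman_le[OF a(1)] order.trans by blast
next
  have "value_iterate n x \<le> bellman limit_value x" for n
  proof (cases n)
    case (Suc m)
    have "bellman (value_iterate m) x \<le> bellman limit_value x"
      by (rule bellman_mono) (auto simp: limit_value_def intro: SUP_upper)
    with Suc show ?thesis by simp
  qed simp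
  then show "limit_value x \<le> bellman limit_value x" unfolding limit_value_def by (rule SUP_least)
qed

lemma value_iterate_le_horizon_value:
  assumes \<pi>: "\<pi> \<in> policies M" and x: "x \<in> nontarget M"
  shows "value_iterate n x \<le> horizon_value \<pi> n t x"
  using x
proof (induction n arbitrary: t x)
  case (Suc n)
  interpret prob_space "\<pi> t x" by (rule prob_space_policy[OF \<pi> Suc.prems])
  have "value_iterate (Suc n) x = (\<integral>\<^sup>+a. value_iterate (Suc n) x \<partial>\<pi> t x)"
    by (simp add: emeasure_space_1)
  also have "\<dots> \<le> horizon_value \<pi> (Suc n) t x"
    unfolding horizon_value.simps
  proof (rule nn_integral_mono_AE)
    show "AE a in \<pi> t x. value_iterate (Suc n) x \<le> one_stage M (horizon_value \<pi> n (Suc t)) x a"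
      using AE_policy[OF \<pi> Suc.prems]
    proof eventually_elim
      case (elim a)
      have "value_iterate (Suc n) x \<le> one_stage M (value_iterate n) x a"
        using bellman_le[OF elim] by simp
      also have "\<dots> \<le> one_stage M (horizon_value \<pi> n (Suc t)) x a"
        by (rule one_stage_mono) (rule Suc.IH)
      finally show ?case .
    qed
  qed
  finally show ?case .
qed simp

lemma opt_value_le: "\<pi> \<in> policies M \<Longrightarrow> opt_value M x \<le> policy_value M \<pi> x"
  unfolding opt_value_def by (rule INF_lower)

theorem opt_value_eq_limit_value:
  assumes x: "x \<in> nontarget M" shows "opt_value M x = limit_value x"
proof (rule antisym)
  obtain f where f: "f \<in> selectors M"
    "\<And>y. y \<in> nontarget M \<Longrightarrow> one_stage M limit_value y (f y) = bellman limit_value y"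
    using bellman_selector[OF limit_value_measurable] by blast
  have "opt_value M x \<le> policy_value M (stationary M f) x"
    by (rule opt_value_le[OF stationary_policy[OF f(1)]])
  also have "\<dots> \<le> limit_value x"
    by (rule stationary_value_le[OF f(1) _ x]) (simp add: f(2) bellman_limit_value)
  finally show "opt_value M x \<le> limit_value x" .
  show "limit_value x \<le> opt_value M x"
    unfolding opt_value_def
  proof (rule INF_greatest)
    fix \<pi> assume \<pi>: "\<pi> \<in> policies M"
    show "limit_value x \<le> policy_value M \<pi> x"
      unfolding limit_value_def policy_value_eq_SUP_horizon_value[OF \<pi> x]
      by (intro SUP_mono' value_iterate_le_horizon_value[OF \<pi> x])
  qed
qed

lemma opt_value_measurable: "measurable_value (opt_value M)"
  by (rule measurable_cong[THEN iffD2, OF _ limit_value_measurable])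
     (simp add: space_restrict_space opt_value_eq_limit_value)

lemma opt_value_eq_bellman: "x \<in> nontarget M \<Longrightarrow> opt_value M x = bellman (opt_value M) x"
  using bellman_cong[of "opt_value M" limit_value x] bellman_limit_value[of x]
  by (simp add: opt_value_eq_limit_value)

section \<open>Optimality equation and optimal stationary policies\<close>
lemma opt_value_least_solution:
  assumes \<xi>: "measurable_value \<xi>" and sol: "solves_optimality_equation M \<xi>" and x: "x \<in> nontarget M"
  shows "opt_value M x \<le> \<xi> x"
proof -
  obtain f where f: "f \<in> selectors M" "\<And>y. y \<in> nontarget M \<Longrightarrow> one_stage M \<xi> y (f y) = bellman \<xi> y"
    using bellman_selector[OF \<xi>] by blast
  have "opt_value M x \<le> policy_value M (stationary M f) x"
    by (rule opt_value_le[OF stationary_policy[OF f(1)]])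
  also have "\<dots> \<le> \<xi> x"
    using sol by (intro stationary_value_le[OF f(1) _ x]) (simp add: f(2) optimality_equation_iff[OF \<xi>])
  finally show ?thesis .
qed

lemma optimal_selector:
  "\<exists>f\<in>selectors M.
     (\<forall>x\<in>nontarget M. is_arg_min (one_stage M (opt_value M) x) (\<lambda>a. a \<in> feasible M x) (f x) \<and>
        opt_value M x = one_stage M (opt_value M) x (f x)) \<and>
     discount_optimal M (stationary M f)"
proof -
  obtain f where f: "f \<in> selectors M"
    "\<And>y. y \<in> nontarget M \<Longrightarrow> one_stage M (opt_value M) y (f y) = bellman (opt_value M) y"
    using bellman_selector[OF opt_value_measurable] by blast
  have eq: "opt_value M x = one_stage M (opt_value M) x (f x)" if "x \<in> nontarget M" for x
    using opt_value_eq_bellman[OF that] f(2)[OF that] by simp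
  have min: "is_arg_min (one_stage M (opt_value M) x) (\<lambda>a. a \<in> feasible M x) (f x)" if "x \<in> nontarget M" for x
    using f(1) that f(2)[OF that] bellman_le[of _ x "opt_value M"]
    by (simp add: is_arg_min_linorder selectors_def)
  have "policy_value M (stationary M f) x = opt_value M x" if x: "x \<in> nontarget M" for x
  proof (rule antisym)
    show "policy_value M (stationary M f) x \<le> opt_value M x"
      by (rule stationary_value_le[OF f(1) _ x]) (simp add: eq[symmetric])
  qed (rule opt_value_le[OF stationary_policy[OF f(1)]])
  then have "discount_optimal M (stationary M f)"
    unfolding discount_optimal_def using stationary_policy[OF f(1)] by blast
  with f(1) eq min show ?thesis by blast
qed

lemma optimal_stationary_equation:
  assumes f: "f \<in> selectors M" and opt: "discount_optimal M (stationary M f)" and x: "x \<in> nontarget M"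
  shows "opt_value M x = one_stage M (opt_value M) x (f x)"
proof -
  have eq: "policy_value M (stationary M f) y = opt_value M y" if "y \<in> nontarget M" for y
    using opt that by (simp add: discount_optimal_def)
  show ?thesis
    using stationary_value_eq[OF f x] one_stage_cong[of "policy_value M (stationary M f)" "opt_value M", OF eq] eq[OF x]
    by simp
qed

end

theorem theorem3p7:
  fixes M :: "('s::polish_space, 'a::polish_space) control_data"
  assumes "control_model M"
    and "\<And>x. x \<in> states M \<Longrightarrow> compact (feasible M x)"
    and "lower_semicontinuous_on (controlled_pairs M) (cost M)"
    and "\<And>z. z \<in> controlled_pairs M \<Longrightarrow> 0 \<le> cost M z"
    and "inf_compact M (cost M)"
    and "strongly_Feller M"
  shows
    "(opt_value M \<in> borel_measurable (restrict_space borel (nontarget M)) \<and>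
      solves_optimality_equation M (opt_value M) \<and>
      (\<forall>\<xi> \<in> borel_measurable (restrict_space borel (nontarget M)).
         solves_optimality_equation M \<xi> \<longrightarrow> (\<forall>x\<in>nontarget M. opt_value M x \<le> \<xi> x))) \<and>
     (\<exists>f\<in>selectors M.
        (\<forall>x\<in>nontarget M.
           is_arg_min (one_stage M (opt_value M) x) (\<lambda>a. a \<in> feasible M x) (f x) \<and>
           opt_value M x = one_stage M (opt_value M) x (f x)) \<and>
        discount_optimal M (stationary M f)) \<and>
     (\<forall>f\<in>selectors M. discount_optimal M (stationary M f) \<longrightarrow>
        (\<forall>x\<in>nontarget M. opt_value M x = one_stage M (opt_value M) x (f x)))"
proof -
  interpret semicontinuous_control_model M
    using assms(1,2,3,4,6) by (simp add: semicontinuous_control_model_def semicontinuous_control_model_axioms_def)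
  show ?thesis
    using opt_value_measurable optimality_equation_iff[OF opt_value_measurable] opt_value_eq_bellman
      opt_value_least_solution optimal_selector optimal_stationary_equation
    by blast
qed

end
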